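(* Let $0<\alpha<1$. For estimating the $\alpha$-Rényi entropy $\mathrm{H}^{\mathrm{R\acute{e}n}}_\alpha(P)=\frac{1}{1-\alpha}\ln\big(\sum_{i=1}^d p_i^\alpha\big)$ of an unknown distribution $P$ on $\{1,\dots,d\}$ to within additive error $\varepsilon$, the quantum query complexity (in the purified quantum query access model) is $\Omega\!\left(d^{\frac{1}{2\alpha}-o(1)}+\frac{d^{\frac{1}{2\alpha}-\frac12}}{\varepsilon^{\frac{1}{2\alpha}}}\right)$.
   Context: Purified quantum query access to a distribution $P=(p_1,\dots,p_d)$: a unitary $U$ on two registers $\mathsf{A},\mathsf{B}$ with $U\ket{0}_{\mathsf A}\ket{0}_{\mathsf B}=\sum_{i=1}^d\sqrt{p_i}\ket{i}_{\mathsf A}\ket{\psi_i}_{\mathsf B}$ for some orthonormal set $\{\ket{\psi_i}\}$; one query means one application of $U$, $U^\dagger$, controlled-$U$ or controlled-$U^\dagger$. The query complexity is the minimum number of queries of a quantum algorithm that outputs an $\varepsilon$-accurate estimate with probability at least $2/3$ for every input distribution; $o(1)$ is as $d\to\infty$. *)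

theory Defs
  imports Complex_Main "Jordan_Normal_Form.Schur_Decomposition"
begin

definition is_distribution :: "nat \<Rightarrow> (nat \<Rightarrow> real) \<Rightarrow> bool" where
  "is_distribution d p \<longleftrightarrow> (\<forall>i<d. 0 \<le> p i) \<and> (\<Sum>i<d. p i) = 1"

text \<open>alpha-Renyi entropy (natural logarithm); note 0 powr alpha = 0.\<close>
definition renyi_entropy :: "real \<Rightarrow> nat \<Rightarrow> (nat \<Rightarrow> real) \<Rightarrow> real" where
  "renyi_entropy \<alpha> d p = (1 / (1 - \<alpha>)) * ln (\<Sum>i<d. p i powr \<alpha>)"

definition unitary_mat :: "nat \<Rightarrow> complex mat \<Rightarrow> bool" where
  "unitary_mat n U \<longleftrightarrow> U \<in> carrier_mat n n \<and> U * mat_adjoint U = 1\<^sub>m n \<and> mat_adjoint U * U = 1\<^sub>m n"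

text \<open>Kronecker (tensor) product; basis index of |a>|b> is a * dim_B + b.\<close>
definition tensor_mat :: "complex mat \<Rightarrow> complex mat \<Rightarrow> complex mat" where
  "tensor_mat A B = mat (dim_row A * dim_row B) (dim_col A * dim_col B)
     (\<lambda>(i, j). A $$ (i div dim_row B, j div dim_col B) * B $$ (i mod dim_row B, j mod dim_col B))"

text \<open>Purified query access: U acts on registers A (dimension d) and B (dimension k) with
  U |0>_A|0>_B = sum_i sqrt(p_i) |i>_A |psi_i>_B for orthonormal psi_0, ..., psi_(d-1).\<close>
definition purified_oracle :: "nat \<Rightarrow> nat \<Rightarrow> (nat \<Rightarrow> real) \<Rightarrow> complex mat \<Rightarrow> bool" where
  "purified_oracle d k p U \<longleftrightarrow> unitary_mat (d * k) U \<and>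
     (\<exists>\<psi> :: nat \<Rightarrow> complex vec.
        (\<forall>i<d. \<psi> i \<in> carrier_vec k) \<and>
        (\<forall>i<d. \<forall>j<d. \<psi> i \<bullet>c \<psi> j = (if i = j then 1 else 0)) \<and>
        U *\<^sub>v unit_vec (d * k) 0 =
          vec (d * k) (\<lambda>n. complex_of_real (sqrt (p (n div k))) * (\<psi> (n div k) $ (n mod k))))"

text \<open>The four kinds of queries on the total space C \<otimes> (A \<otimes> B) \<otimes> W, where C is a control qubit
  and W a workspace of dimension w: 0 = U, 1 = U^dagger, 2 = controlled-U, 3 = controlled-U^dagger.\<close>
definition query_op :: "nat \<Rightarrow> complex mat \<Rightarrow> nat \<Rightarrow> complex mat" where
  "query_op w U q =
     (let V = (if q = 0 \<or> q = 2 then U else mat_adjoint U);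
          n = dim_row U;
          P0 = mat 2 2 (\<lambda>(i, j). if i = 0 \<and> j = 0 then 1 else 0);
          P1 = mat 2 2 (\<lambda>(i, j). if i = 1 \<and> j = 1 then 1 else 0)
      in if q \<le> 1 then tensor_mat (1\<^sub>m 2) (tensor_mat V (1\<^sub>m w))
         else tensor_mat P0 (1\<^sub>m (n * w)) + tensor_mat P1 (tensor_mat V (1\<^sub>m w)))"

text \<open>A T-query algorithm: workspace dimension w, unitaries Vs = [V_0, ..., V_T] on the total
  space of dimension 2*(d*k)*w, query kinds qs = [q_1, ..., q_T], and an estimate attached to each
  computational-basis measurement outcome. Final state V_T Q_T ... V_1 Q_1 V_0 |0>.\<close>
fun run_alg :: "nat \<Rightarrow> complex mat \<Rightarrow> complex mat list \<Rightarrow> nat list \<Rightarrow> complex vec \<Rightarrow> complex vec" where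
  "run_alg w U [V] qs s = V *\<^sub>v s"
| "run_alg w U (V # Vs) (q # qs) s = run_alg w U Vs qs (query_op w U q *\<^sub>v (V *\<^sub>v s))"
| "run_alg w U Vs qs s = s"

definition final_state :: "nat \<Rightarrow> nat \<Rightarrow> nat \<Rightarrow> complex mat \<Rightarrow> complex mat list \<Rightarrow> nat list \<Rightarrow> complex vec" where
  "final_state d k w U Vs qs = run_alg w U Vs qs (unit_vec (2 * (d * k) * w) 0)"

definition valid_alg :: "nat \<Rightarrow> nat \<Rightarrow> nat \<Rightarrow> nat \<Rightarrow> complex mat list \<Rightarrow> nat list \<Rightarrow> bool" where
  "valid_alg d k T w Vs qs \<longleftrightarrow> 1 \<le> w \<and> length qs = T \<and> length Vs = T + 1 \<and>
     (\<forall>q\<in>set qs. q \<le> 3) \<and> (\<forall>V\<in>set Vs. unitary_mat (2 * (d * k) * w) V)"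

definition success_prob :: "nat \<Rightarrow> nat \<Rightarrow> nat \<Rightarrow> complex mat \<Rightarrow> complex mat list \<Rightarrow> nat list
     \<Rightarrow> (nat \<Rightarrow> real) \<Rightarrow> real \<Rightarrow> real \<Rightarrow> real" where
  "success_prob d k w U Vs qs out h \<epsilon> =
     (\<Sum>n | n < 2 * (d * k) * w \<and> \<bar>out n - h\<bar> \<le> \<epsilon>. (cmod (final_state d k w U Vs qs $ n))\<^sup>2)"

definition renyi_solvable :: "real \<Rightarrow> nat \<Rightarrow> real \<Rightarrow> nat \<Rightarrow> bool" where
  "renyi_solvable \<alpha> d \<epsilon> T \<longleftrightarrow>
     (\<forall>k. \<exists>w Vs qs out. valid_alg d k T w Vs qs \<and>
        (\<forall>p U. is_distribution d p \<longrightarrow> purified_oracle d k p U \<longrightarrow>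
           success_prob d k w U Vs qs out (renyi_entropy \<alpha> d p) \<epsilon> \<ge> 2 / 3))"

end

theory Submission
  imports Defs
begin

text \<open>The lower bound is obtained by the polynomial method. If the oracle is the reflection that
  exchanges \<open>|0>|0>\<close> with the purification of \<open>p\<close>, the acceptance probability of a \<open>T\<close>-query
  algorithm is a polynomial of degree \<open>4 T\<close> in the amplitudes; averaged over random signs of the
  amplitudes it becomes a polynomial of degree \<open>2 T\<close> in the probabilities, bounded by 1 on the
  whole simplex. A univariate polynomial of degree \<open>D\<close> that is bounded by 1 on \<open>[0, R]\<close> and
  vanishes to order \<open>n\<close> at 0 is \<open>O((D\<^sup>2 / R) ^ n)\<close> at 1.

  Take a heavy item and \<open>d - 1\<close> light ones. For the precision term, the total light mass is
  scaled from 0 to a value that moves the entropy by \<open>3 \<epsilon>\<close>, with \<open>n = 1\<close>. For the other term,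
  the light masses are independent, of size about \<open>d powr (- 1 / \<alpha>)\<close>, drawn from one of two laws
  that agree in their first \<open>n\<close> moments (of order 0 to \<open>n - 1\<close>) but typically lead to entropies
  a constant apart. Exchanging the laws one item at a time changes the average of the polynomial
  by at most \<open>O((T\<^sup>2 / d powr (1 / \<alpha>)) ^ n)\<close> per item, whence \<open>T\<close> is at least
  \<open>d powr (1 / (2 * \<alpha>) - 1 / n)\<close> for large \<open>d\<close>; finally let \<open>n\<close> grow slowly with \<open>d\<close>.\<close>

section \<open>Polynomials that are flat at the origin\<close>

lemma prod_square_diff:
  fixes j m :: nat
  assumes "1 \<le> j" "j \<le> m"
  shows "(\<Prod>i\<in>{1..m}-{j}. real i ^ 2 / \<bar>real i ^ 2 - real j ^ 2\<bar>)
       = 2 * (fact m)\<^sup>2 / (fact (m - j) * fact (m + j))"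
  using assms(2)
proof (induction m rule: dec_induct)
  case base
  obtain k where k: "j = Suc k" using assms(1) by (cases j) auto
  have s: "{1..j} - {j} = {1..k}" using k by auto
  have a: "(\<Prod>i=1..k. real i) = fact k"
    by (simp add: fact_prod)
  have b: "(\<Prod>i=1..k. real (j - i)) = fact k"
  proof -
    have "(\<Prod>i=1..k. real (j - i)) = (\<Prod>i=1..k. real i)"
      by (rule prod.reindex_bij_witness[of _ "\<lambda>i. j - i" "\<lambda>i. j - i"]) (auto simp: k)
    then show ?thesis using a by simp
  qed
  have c: "fact j * (\<Prod>i=1..l. real (j + i)) = fact (j + l)" for l
  proof (induction l)
    case (Suc l)
    have "fact j * (\<Prod>i=1..Suc l. real (j + i)) = (fact j * (\<Prod>i=1..l. real (j + i))) * real (j + Suc l)"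
      by simp
    then show ?case unfolding Suc.IH by simp
  qed simp
  have "(\<Prod>i\<in>{1..j}-{j}. real i ^ 2 / \<bar>real i ^ 2 - real j ^ 2\<bar>)
      = (\<Prod>i=1..k. real i * real i / (real (j - i) * real (j + i)))"
    unfolding s
  proof (rule prod.cong[OF refl])
    fix i assume i: "i \<in> {1..k}"
    have "real i ^ 2 < real j ^ 2" using i k by (intro power_strict_mono) auto
    then have "\<bar>real i ^ 2 - real j ^ 2\<bar> = real j ^ 2 - real i ^ 2" by linarith
    also have "\<dots> = (real j - real i) * (real j + real i)"
      by (simp add: power2_eq_square algebra_simps)
    finally have "\<bar>real i ^ 2 - real j ^ 2\<bar> = (real j - real i) * (real j + real i)" .
    then show "(real i)\<^sup>2 / \<bar>(real i)\<^sup>2 - (real j)\<^sup>2\<bar> = real i * real i / (real (j - i) * real (j + i))"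
      using i k by (simp add: of_nat_diff power2_eq_square)
  qed
  also have "\<dots> = fact k * fact k / (fact k * (\<Prod>i=1..k. real (j + i)))"
    by (simp only: prod_dividef prod.distrib a b)
  also have "\<dots> = fact k * fact k * fact j / (fact k * fact (j + k))"
    by (simp flip: c)
  also have "\<dots> = 2 * (fact j)\<^sup>2 / (fact (j - j) * fact (j + j))"
  proof -
    have "(fact j :: real) = real j * fact k" "(fact (j + j) :: real) = 2 * real j * fact (j + k)"
      by (simp_all add: k)
    moreover have "real j > 0" "(fact k :: real) > 0" "(fact (j + k) :: real) > 0" using k by auto
    ultimately show ?thesis by (simp add: power2_eq_square)
  qed
  finally show ?case .
next
  case (step m)
  have s: "{1..Suc m} - {j} = insert (Suc m) ({1..m} - {j})"
    using step by auto
  have p: "real j < real (Suc m)" using step by simp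
  have sq: "\<bar>real (Suc m) ^ 2 - real j ^ 2\<bar> = real (Suc m - j) * real (Suc m + j)"
  proof -
    have "real j ^ 2 < real (Suc m) ^ 2" using p by (intro power_strict_mono) auto
    then have "\<bar>real (Suc m) ^ 2 - real j ^ 2\<bar> = real (Suc m) ^ 2 - real j ^ 2" by linarith
    also have "\<dots> = (real (Suc m) - real j) * (real (Suc m) + real j)"
      by (simp add: power2_eq_square algebra_simps)
    also have "\<dots> = real (Suc m - j) * real (Suc m + j)"
      using p by (simp only: of_nat_add of_nat_diff[OF less_imp_le[OF p[unfolded of_nat_less_iff]]])
    finally show ?thesis .
  qed
  have f1: "(fact (Suc m - j) :: real) = real (Suc m - j) * fact (m - j)"
    using step by (simp add: Suc_diff_le)
  have f2: "(fact (Suc m + j) :: real) = real (Suc m + j) * fact (m + j)" by simp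
  have f3: "(fact (Suc m) :: real) = real (Suc m) * fact m" by simp
  have "(\<Prod>i\<in>{1..Suc m}-{j}. real i ^ 2 / \<bar>real i ^ 2 - real j ^ 2\<bar>)
     = real (Suc m) ^ 2 / \<bar>real (Suc m) ^ 2 - real j ^ 2\<bar> * (2 * (fact m)\<^sup>2 / (fact (m - j) * fact (m + j)))"
    unfolding s using step by (subst prod.insert) auto
  also have "\<dots> = 2 * (fact (Suc m))\<^sup>2 / (fact (Suc m - j) * fact (Suc m + j))"
    unfolding sq f1 f2 f3 by (simp add: power2_eq_square mult.assoc mult.left_commute)
  finally show ?case .
qed

lemma fact_square_le: "j \<le> m \<Longrightarrow> (fact m :: real)\<^sup>2 \<le> fact (m - j) * fact (m + j)"
proof (induction j)
  case 0 then show ?case by (simp add: power2_eq_square)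
next
  case (Suc j)
  have "(fact (m - j) :: real) = real (m - j) * fact (m - Suc j)"
    using Suc.prems by (metis Suc_diff_Suc Suc_le_lessD fact_Suc)
  then have "(fact (m - j) * fact (m + j) :: real) = real (m - j) * (fact (m - Suc j) * fact (m + j))"
    by simp
  also have "\<dots> \<le> real (m + Suc j) * (fact (m - Suc j) * fact (m + j))"
    by (intro mult_right_mono) auto
  also have "\<dots> = fact (m - Suc j) * fact (m + Suc j)" by simp
  finally have "(fact (m - j) * fact (m + j) :: real) \<le> fact (m - Suc j) * fact (m + Suc j)" .
  moreover have "(fact m :: real)\<^sup>2 \<le> fact (m - j) * fact (m + j)"
    using Suc.IH Suc.prems by linarith
  ultimately show ?case by (rule order_trans[rotated])
qed

lemma sum_inverse_squares_le: "(\<Sum>j=1..m. 1 / (real j)\<^sup>2) \<le> 2"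
proof -
  have "(\<Sum>j=1..Suc m. 1 / (real j)\<^sup>2) \<le> 2 - 1 / real (Suc m)" for m
  proof (induction m)
    case (Suc m)
    have "1 / (x + 1)\<^sup>2 \<le> 1 / x - 1 / (x + 1)" if "0 < x" for x :: real
      using that by (simp add: divide_simps power2_eq_square)
    from this[of "real (Suc m)"]
    have "1 / (real (Suc (Suc m)))\<^sup>2 \<le> 1 / real (Suc m) - 1 / real (Suc (Suc m))"
      by (simp add: add.commute)
    moreover have "(\<Sum>j=1..Suc (Suc m). 1 / (real j)\<^sup>2) = (\<Sum>j=1..Suc m. 1 / (real j)\<^sup>2) + 1 / (real (Suc (Suc m)))\<^sup>2"
      by (rule sum.cl_ivl_Suc[THEN trans]) simp
    ultimately show ?case using Suc by linarith
  qed simp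
  then have "(\<Sum>j=1..Suc m. 1 / (real j)\<^sup>2) \<le> 2" for m
    by (rule order_trans) simp
  then show ?thesis by (cases m) simp_all
qed

lemma lagrange_interpolation:
  fixes h :: "real poly"
  assumes "finite J" "inj_on x J" "degree h < card J"
  shows "poly h z = (\<Sum>j\<in>J. poly h (x j) * (\<Prod>i\<in>J-{j}. (z - x i) / (x j - x i)))"
proof -
  define L where "L j = (\<Prod>i\<in>J-{j}. [:- x i / (x j - x i), 1 / (x j - x i):])" for j
  define g where "g = (\<Sum>j\<in>J. smult (poly h (x j)) (L j))"
  have pL: "poly (L j) t = (\<Prod>i\<in>J-{j}. (t - x i) / (x j - x i))" for j t
    unfolding L_def poly_prod by (intro prod.cong) (auto simp: diff_divide_distrib)
  have dL: "degree (L j) < card J" if "j \<in> J" for j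
  proof -
    have "degree (L j) \<le> (\<Sum>i\<in>J-{j}. degree [:- x i / (x j - x i), 1 / (x j - x i):])"
      unfolding L_def using assms(1) by (intro degree_prod_sum_le[unfolded o_def]) auto
    also have "\<dots> \<le> (\<Sum>i\<in>J-{j}. 1)" by (intro sum_mono) auto
    also have "\<dots> < card J" using assms(1) that by (simp only: sum_constant) (simp add: card_Diff1_less del: card_Diff_insert card_Diff_singleton)
    finally show ?thesis .
  qed
  have dg: "degree g < card J"
  proof -
    have "card J > 0" using assms(3) by simp
    then show ?thesis unfolding g_def
      by (intro le_less_trans[OF degree_sum_le[OF assms(1), of _ "card J - 1"]])
        (auto dest!: dL intro!: le_trans[OF degree_smult_le])
  qed
  have ev: "poly g (x j) = poly h (x j)" if "j \<in> J" for j
  proof -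
    have "poly g (x j) = (\<Sum>j'\<in>J. if j' = j then poly h (x j) else 0)"
      unfolding g_def poly_sum
    proof (intro sum.cong refl)
      fix j' assume j': "j' \<in> J"
      show "poly (smult (poly h (x j')) (L j')) (x j) = (if j' = j then poly h (x j) else 0)"
      proof (cases "j' = j")
        case True
        have "poly (L j) (x j) = 1" unfolding pL
          using assms(2) that by (intro prod.neutral) (auto simp: inj_on_def)
        then show ?thesis using True by simp
      next
        case False
        have "poly (L j') (x j) = 0" unfolding pL
          using assms(1) that False by (intro prod_zero) (auto intro!: bexI[of _ j])
        then show ?thesis using False by simp
      qed
    qed
    then show ?thesis using that assms(1) by simp
  qed
  have "h = g"
  proof (rule ccontr)
    assume "h \<noteq> g"
    then have nz: "h - g \<noteq> 0" by simp
    have "card (x ` J) \<le> card {z. poly (h - g) z = 0}"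
      using ev by (intro card_mono poly_roots_finite nz) auto
    also have "\<dots> \<le> degree (h - g)" by (rule card_poly_roots_bound[OF nz])
    also have "\<dots> < card J" using assms(3) dg by (rule degree_diff_less)
    finally show False using card_image[OF assms(2)] by simp
  qed
  then have "poly h z = (\<Sum>j\<in>J. poly (smult (poly h (x j)) (L j)) z)"
    unfolding g_def by (metis poly_sum)
  then show ?thesis by (simp add: pL)
qed

lemma bounded_poly_flat_at_zero:
  fixes g :: "real poly"
  assumes deg: "degree g \<le> D" and van: "\<And>r. r < n \<Longrightarrow> coeff g r = 0" and n: "1 \<le> n"
    and bd: "\<And>t. 0 \<le> t \<Longrightarrow> t \<le> R \<Longrightarrow> \<bar>poly g t\<bar> \<le> 1" and R: "1 < R"
  shows "\<bar>poly g 1\<bar> \<le> 4 * ((real D + 1)\<^sup>2 / (R - 1)) ^ n"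
proof -
  have "monom 1 n dvd g" using van by (simp add: monom_1_dvd_iff')
  then obtain h where h: "g = monom 1 n * h" by blast
  have dh: "degree h \<le> D"
    by (cases "h = 0") (use deg h in \<open>auto simp: degree_mult_eq degree_monom_eq\<close>)
  define m where "m = D + 1"
  define s where "s = (R - 1) / (real m)\<^sup>2"
  have s: "0 < s" using R by (simp add: s_def m_def)
  define x where "x j = 1 + s * (real j)\<^sup>2" for j :: nat
  have inj: "inj_on x {1..m}"
    using s by (auto simp: inj_on_def x_def)
  have "poly h 1 = (\<Sum>j=1..m. poly h (x j) * (\<Prod>i\<in>{1..m}-{j}. (1 - x i) / (x j - x i)))"
    by (rule lagrange_interpolation) (use dh inj in \<open>auto simp: m_def\<close>)
  also have "\<bar>\<dots>\<bar> \<le> (\<Sum>j=1..m. \<bar>poly h (x j) * (\<Prod>i\<in>{1..m}-{j}. (1 - x i) / (x j - x i))\<bar>)"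
    by (rule sum_abs)
  also have "\<dots> \<le> (\<Sum>j=1..m. 2 / s ^ n * (1 / (real j)\<^sup>2))"
  proof (rule sum_mono)
    fix j assume j: "j \<in> {1..m}"
    have "\<bar>\<Prod>i\<in>{1..m}-{j}. (1 - x i) / (x j - x i)\<bar> = (\<Prod>i\<in>{1..m}-{j}. real i ^ 2 / \<bar>real i ^ 2 - real j ^ 2\<bar>)"
      unfolding abs_prod
    proof (rule prod.cong[OF refl])
      fix i assume "i \<in> {1..m} - {j}"
      have "(1 - x i) / (x j - x i) = (- s * (real i)\<^sup>2) / (s * ((real j)\<^sup>2 - (real i)\<^sup>2))"
        by (simp add: x_def algebra_simps)
      also have "\<dots> = - ((real i)\<^sup>2 / ((real j)\<^sup>2 - (real i)\<^sup>2))" using s by simp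
      finally show "\<bar>(1 - x i) / (x j - x i)\<bar> = real i ^ 2 / \<bar>real i ^ 2 - real j ^ 2\<bar>"
        by (simp add: abs_minus_commute)
    qed
    also have "\<dots> \<le> 2"
    proof -
      have "(fact (m - j) * fact (m + j) :: real) > 0" by simp
      then have "2 * (fact m)\<^sup>2 / (fact (m - j) * fact (m + j) :: real) \<le> 2"
        using fact_square_le[of j m] j by (subst pos_divide_le_eq) auto
      then show ?thesis using prod_square_diff[of j m] j by simp
    qed
    finally have w: "\<bar>\<Prod>i\<in>{1..m}-{j}. (1 - x i) / (x j - x i)\<bar> \<le> 2" .
    have xj: "s * (real j)\<^sup>2 \<le> x j" "0 < x j" "0 < s * (real j)\<^sup>2" using s j by (auto simp: x_def add_pos_nonneg)
    have "x j \<le> 1 + s * (real m)\<^sup>2" unfolding x_def using s j by (auto intro!: mult_left_mono power_mono)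
    also have "\<dots> = R" by (simp add: s_def m_def)
    finally have "\<bar>poly g (x j)\<bar> \<le> 1" using bd xj by auto
    then have "x j ^ n * \<bar>poly h (x j)\<bar> \<le> 1"
      using xj by (simp add: h poly_monom abs_mult)
    then have "\<bar>poly h (x j)\<bar> \<le> 1 / x j ^ n" using xj by (simp add: field_simps)
    also have "\<dots> \<le> 1 / (s * (real j)\<^sup>2) ^ n"
      using xj by (intro divide_left_mono power_mono mult_pos_pos[of "_ ^ n"] zero_less_power) auto
    also have "\<dots> = 1 / s ^ n * (1 / ((real j)\<^sup>2) ^ n)" by (simp add: power_mult_distrib)
    also have "\<dots> \<le> 1 / s ^ n * (1 / (real j)\<^sup>2)"
    proof -
      have "((real j)\<^sup>2) ^ 1 \<le> ((real j)\<^sup>2) ^ n" using j n by (intro power_increasing) auto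
      then show ?thesis using j s by (intro mult_left_mono divide_left_mono) auto
    qed
    finally have "\<bar>poly h (x j)\<bar> \<le> 1 / s ^ n * (1 / (real j)\<^sup>2)" .
    then have "\<bar>poly h (x j)\<bar> * \<bar>\<Prod>i\<in>{1..m}-{j}. (1 - x i) / (x j - x i)\<bar> \<le> (1 / s ^ n * (1 / (real j)\<^sup>2)) * 2"
      using s by (intro mult_mono w) auto
    then show "\<bar>poly h (x j) * (\<Prod>i\<in>{1..m}-{j}. (1 - x i) / (x j - x i))\<bar> \<le> 2 / s ^ n * (1 / (real j)\<^sup>2)"
      by (simp add: abs_mult mult.commute)
  qed
  also have "\<dots> = 2 / s ^ n * (\<Sum>j=1..m. 1 / (real j)\<^sup>2)" by (simp add: sum_distrib_left)
  also have "\<dots> \<le> 2 / s ^ n * 2" using s by (intro mult_left_mono sum_inverse_squares_le) auto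
  also have "\<dots> = 4 * ((real D + 1)\<^sup>2 / (R - 1)) ^ n"
    by (simp add: s_def m_def power_divide add.commute)
  finally show ?thesis by (simp add: h poly_monom)
qed

section \<open>Laws with matching moments\<close>

lemma coeff_prod_nonneg:
  fixes p :: "'b \<Rightarrow> 'a :: linordered_idom poly"
  assumes "\<And>i k. i \<in> A \<Longrightarrow> 0 \<le> coeff (p i) k"
  shows "0 \<le> coeff (\<Prod>i\<in>A. p i) k"
  using assms
proof (induction A arbitrary: k rule: infinite_finite_induct)
  case (insert i A)
  then show ?case by (auto simp: coeff_mult intro!: sum_nonneg mult_nonneg_nonneg)
qed auto

lemma poly_eq_sum_atMost:
  fixes p :: "'a :: comm_semiring_1 poly"
  assumes "degree p \<le> n"
  shows "poly p z = (\<Sum>j\<le>n. coeff p j * z ^ j)"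
  unfolding poly_altdef using assms by (intro sum.mono_neutral_left) (auto simp: coeff_eq_0)

text \<open>The weights are the coefficients of \<open>\<Prod>r<n. (1 + z / s^r)\<close>, split by the parity of the
  degree; their signed version has the roots \<open>s^r\<close>, which is the equality of the moments.
  For large \<open>s\<close> the even part concentrates on the point 1 and the odd part on the point \<open>s\<close>.\<close>

lemma moment_matching_weights:
  fixes \<alpha> \<kappa> :: real
  assumes \<alpha>: "0 < \<alpha>" "\<alpha> < 1" and n: "1 \<le> n" and \<kappa>: "0 < \<kappa>"
  obtains s :: real and \<mu> \<nu> :: "nat \<Rightarrow> real" where "1 < s"
    "\<And>j. 0 \<le> \<mu> j" "\<And>j. 0 \<le> \<nu> j" "(\<Sum>j\<le>n. \<mu> j) = 1" "(\<Sum>j\<le>n. \<nu> j) = 1"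
    "\<And>r. r < n \<Longrightarrow> (\<Sum>j\<le>n. \<mu> j * (s ^ j) ^ r) = (\<Sum>j\<le>n. \<nu> j * (s ^ j) ^ r)"
    "(\<Sum>j\<le>n. \<nu> j * of_bool (j \<noteq> 1)) \<le> \<kappa>"
    "(\<Sum>j\<le>n. \<mu> j * (s ^ j / s) powr \<alpha>) \<le> \<kappa>"
proof -
  have lim0: "((\<lambda>s::real. s powr \<beta> / s ^ r) \<longlongrightarrow> 0) at_top" if "\<beta> < 1" "1 \<le> r" for r :: nat and \<beta>
  proof -
    have "((\<lambda>s::real. s powr (\<beta> - real r)) \<longlongrightarrow> 0) at_top"
      using that by (intro tendsto_neg_powr filterlim_ident) auto
    then show ?thesis
      by (rule Lim_transform_eventually)
        (use eventually_gt_at_top[of 0] in eventually_elim, auto simp: powr_diff powr_realpow)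
  qed
  have limP: "((\<lambda>s::real. \<Prod>r\<in>{1..<n}. 1 + s powr \<beta> / s ^ r) \<longlongrightarrow> 1) at_top" if "\<beta> < 1" for \<beta>
  proof -
    have "((\<lambda>s::real. \<Prod>r\<in>{1..<n}. 1 + s powr \<beta> / s ^ r) \<longlongrightarrow> (\<Prod>r\<in>{1..<n}. 1 + 0)) at_top"
      using that by (intro tendsto_prod tendsto_add tendsto_const lim0) auto
    then show ?thesis by simp
  qed
  have "((\<lambda>s::real. (1 + s powr - \<alpha>) * (\<Prod>r\<in>{1..<n}. 1 + s powr \<alpha> / s ^ r)) \<longlongrightarrow> (1 + 0) * 1) at_top"
    using \<alpha> by (intro tendsto_mult tendsto_add tendsto_const tendsto_neg_powr filterlim_ident limP) auto
  then have ev1: "\<forall>\<^sub>F s::real in at_top. (1 + s powr - \<alpha>) * (\<Prod>r\<in>{1..<n}. 1 + s powr \<alpha> / s ^ r) < 1 + \<kappa>"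
    using \<kappa> by (intro order_tendstoD(2)) auto
  have ev2: "\<forall>\<^sub>F s::real in at_top. (\<Prod>r\<in>{1..<n}. 1 + s powr 0 / s ^ r) < 1 + \<kappa>"
    using \<kappa> by (intro order_tendstoD(2)[OF limP]) auto
  obtain s :: real where s: "1 < s"
    and s1: "(1 + s powr - \<alpha>) * (\<Prod>r\<in>{1..<n}. 1 + s powr \<alpha> / s ^ r) < 1 + \<kappa>"
    and s2: "(\<Prod>r\<in>{1..<n}. 1 + s powr 0 / s ^ r) < 1 + \<kappa>"
    using eventually_happens'[OF _ eventually_conj[OF eventually_gt_at_top[of 1] eventually_conj[OF ev1 ev2]]]
    by auto
  define Q where "Q = (\<Prod>r\<in>{1..<n}. [:1, 1 / s ^ r:])"
  define P where "P = [:1, 1:] * Q"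
  define a where "a = coeff P"
  have pQ: "poly Q z = (\<Prod>r\<in>{1..<n}. 1 + z / s ^ r)" for z
    by (simp add: Q_def poly_prod)
  have ivl: "{..<n} = insert 0 {1..<n}" using n by auto
  have pP: "poly P z = (\<Prod>r<n. 1 + z / s ^ r)" for z
    unfolding ivl P_def by (simp add: pQ distrib_right)
  have "degree Q \<le> n - 1"
  proof -
    have "degree Q \<le> (\<Sum>r\<in>{1..<n}. degree [:1, 1 / s ^ r:])"
      unfolding Q_def by (intro degree_prod_sum_le[unfolded o_def]) auto
    also have "\<dots> \<le> (\<Sum>r\<in>{1..<n}. 1)" by (intro sum_mono) auto
    finally show ?thesis by simp
  qed
  then have "degree P \<le> n"
    unfolding P_def using degree_mult_le[of "[:1, 1:]" Q] n by (auto simp: degree_pCons_eq_if)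
  then have Psum: "poly P z = (\<Sum>j\<le>n. a j * z ^ j)" for z
    unfolding a_def by (rule poly_eq_sum_atMost)
  have Qnn: "0 \<le> coeff Q j" for j
    unfolding Q_def using s by (intro coeff_prod_nonneg) (auto simp: coeff_pCons split: nat.splits)
  have ann: "0 \<le> a j" for j
    unfolding a_def P_def using Qnn by (cases j) (auto simp: coeff_pCons)
  have "coeff Q 0 = 1" using pQ[of 0] by (simp add: poly_0_coeff_0)
  then have a01: "1 \<le> a 0" "1 \<le> a 1"
    unfolding a_def P_def using Qnn[of 1] by auto
  have neg: "(\<Sum>j\<le>n. a j * (- z) ^ j) = 
    (\<Sum>j\<le>n. a j * of_bool (even j) * z ^ j) - (\<Sum>j\<le>n. a j * of_bool (odd j) * z ^ j)" for z
    unfolding sum_subtractf[symmetric] by (intro sum.cong) (auto simp: uminus_power_if)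
  have pos: "(\<Sum>j\<le>n. a j * z ^ j) = 
    (\<Sum>j\<le>n. a j * of_bool (even j) * z ^ j) + (\<Sum>j\<le>n. a j * of_bool (odd j) * z ^ j)" for z
    unfolding sum.distrib[symmetric] by (intro sum.cong) auto
  have root: "poly P (- (s ^ r)) = 0" if "r < n" for r
    unfolding pP using that s by (intro prod_zero) (auto intro!: bexI[of _ r])
  have mom: "(\<Sum>j\<le>n. a j * of_bool (even j) * (s ^ r) ^ j) = (\<Sum>j\<le>n. a j * of_bool (odd j) * (s ^ r) ^ j)"
    if "r < n" for r
    using root[OF that] neg[of "s ^ r"] by (simp add: Psum)
  define W where "W = (\<Sum>j\<le>n. a j * of_bool (even j))"
  have Wodd: "W = (\<Sum>j\<le>n. a j * of_bool (odd j))"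
    using mom[of 0] n by (simp add: W_def)
  have "2 * W = poly P 1"
    using pos[of 1] Wodd by (simp add: Psum flip: W_def)
  also have "\<dots> = 2 * poly Q 1" by (simp add: P_def)
  finally have WQ: "W = poly Q 1" by simp
  have Wub: "W < 1 + \<kappa>" using s2 s unfolding WQ pQ by simp
  have "a 0 * of_bool (even (0::nat)) \<le> W"
    unfolding W_def using ann by (intro member_le_sum) auto
  then have W1: "1 \<le> W" using a01 by simp
  define \<mu> where "\<mu> j = a j * of_bool (even j) / W" for j
  define \<nu> where "\<nu> j = a j * of_bool (odd j) / W" for j
  show ?thesis
  proof
    show "1 < s" by fact
    show "0 \<le> \<mu> j" "0 \<le> \<nu> j" for j
      using ann W1 by (auto simp: \<mu>_def \<nu>_def)
    show s\<mu>: "(\<Sum>j\<le>n. \<mu> j) = 1" and s\<nu>: "(\<Sum>j\<le>n. \<nu> j) = 1"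
      unfolding \<mu>_def \<nu>_def sum_divide_distrib[symmetric] using W1 W_def Wodd by simp_all
    show "(\<Sum>j\<le>n. \<mu> j * (s ^ j) ^ r) = (\<Sum>j\<le>n. \<nu> j * (s ^ j) ^ r)" if "r < n" for r
    proof -
      have c: "(s ^ j) ^ r = (s ^ r) ^ j" for j by (simp add: mult.commute flip: power_mult)
      show ?thesis unfolding \<mu>_def \<nu>_def c
        using mom[OF that] by (simp flip: sum_divide_distrib)
    qed
    have "(\<Sum>j\<le>n. \<nu> j * of_bool (j \<noteq> 1)) = (\<Sum>j\<le>n. \<nu> j - (if j = 1 then \<nu> 1 else 0))"
      by (intro sum.cong) auto
    also have "\<dots> = 1 - \<nu> 1" using n by (simp add: sum_subtractf s\<nu>)
    also have "\<dots> \<le> 1 - 1 / W" using a01 W1 by (simp add: \<nu>_def divide_right_mono)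
    also have "1 - 1 / W \<le> \<kappa>"
    proof -
      have "1 - 1 / W = (W - 1) / W" using W1 by (simp add: diff_divide_distrib)
      also have "\<dots> \<le> W - 1" using W1 by (simp add: divide_le_eq mult_le_cancel_left1)
      also have "\<dots> \<le> \<kappa>" using Wub by simp
      finally show ?thesis .
    qed
    finally show "(\<Sum>j\<le>n. \<nu> j * of_bool (j \<noteq> 1)) \<le> \<kappa>" by simp
    define z where "z = s powr \<alpha>"
    have z: "0 < z" using s by (simp add: z_def)
    have pw: "(s ^ j / s) powr \<alpha> = z ^ j / z" for j
      using s by (simp add: z_def powr_divide powr_realpow[symmetric] powr_powr mult.commute)
    have "a 1 * of_bool (odd (1::nat)) * z ^ 1 \<le> (\<Sum>j\<le>n. a j * of_bool (odd j) * z ^ j)"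
      using ann z n by (intro member_le_sum[of 1]) auto
    then have "z \<le> (\<Sum>j\<le>n. a j * of_bool (odd j) * z ^ j)"
      using a01 z by (simp add: order_trans[rotated])
    then have "(\<Sum>j\<le>n. a j * of_bool (even j) * z ^ j) \<le> poly P z - z"
      using pos[of z] by (simp add: Psum)
    also have "poly P z = z * ((1 + 1 / z) * poly Q z)"
      using z by (simp add: P_def field_simps)
    also have "\<dots> \<le> z * (1 + \<kappa>)"
      using s1 z s by (intro mult_left_mono) (auto simp: pQ z_def powr_minus_divide)
    finally have ub: "(\<Sum>j\<le>n. a j * of_bool (even j) * z ^ j) \<le> \<kappa> * z"
      by (simp add: algebra_simps)
    have "(\<Sum>j\<le>n. \<mu> j * (s ^ j / s) powr \<alpha>) = (\<Sum>j\<le>n. a j * of_bool (even j) * z ^ j) / (W * z)"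
      unfolding pw \<mu>_def sum_divide_distrib by (intro sum.cong) auto
    also have "\<dots> \<le> \<kappa> * z / (W * z)" using ub z W1 by (intro divide_right_mono) auto
    also have "\<dots> = \<kappa> / W" using z by simp
    also have "\<dots> \<le> \<kappa>" using W1 \<kappa> by (simp add: divide_le_eq)
    finally show "(\<Sum>j\<le>n. \<mu> j * (s ^ j / s) powr \<alpha>) \<le> \<kappa>" .
  qed
qed

lemma moment_matching_poly_diff:
  fixes G :: "real poly" and \<mu> \<nu> x :: "nat \<Rightarrow> real"
  assumes deg: "degree G \<le> D" and n: "1 \<le> n" and R: "1 < R"
    and nn: "\<And>j. 0 \<le> \<mu> j" "\<And>j. 0 \<le> \<nu> j" "(\<Sum>j\<le>N. \<mu> j) = 1" "(\<Sum>j\<le>N. \<nu> j) = 1"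
    and mom: "\<And>r. r < n \<Longrightarrow> (\<Sum>j\<le>N. \<mu> j * x j ^ r) = (\<Sum>j\<le>N. \<nu> j * x j ^ r)"
    and x: "\<And>j. j \<le> N \<Longrightarrow> 0 \<le> x j" "\<And>j. j \<le> N \<Longrightarrow> x j \<le> X"
    and bd: "\<And>t. 0 \<le> t \<Longrightarrow> t \<le> R * X \<Longrightarrow> 0 \<le> poly G t \<and> poly G t \<le> 1"
  shows "\<bar>(\<Sum>j\<le>N. \<nu> j * poly G (x j)) - (\<Sum>j\<le>N. \<mu> j * poly G (x j))\<bar>
     \<le> 4 * ((real D + 1)\<^sup>2 / (R - 1)) ^ n"
proof -
  define g where "g = (\<Sum>j\<le>N. smult (\<nu> j - \<mu> j) (pcompose G [:0, x j:]))"
  have pg: "poly g t = (\<Sum>j\<le>N. \<nu> j * poly G (t * x j)) - (\<Sum>j\<le>N. \<mu> j * poly G (t * x j))" for t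
    by (simp add: g_def poly_sum poly_pcompose left_diff_distrib sum_subtractf)
  have "\<bar>poly g 1\<bar> \<le> 4 * ((real D + 1)\<^sup>2 / (R - 1)) ^ n"
  proof (rule bounded_poly_flat_at_zero[OF _ _ n _ R])
    show "degree g \<le> D" unfolding g_def
    proof (intro degree_sum_le, simp)
      fix j
      have "degree (pcompose G [:0, x j:]) \<le> degree G * degree [:0, x j:]" by (rule degree_pcompose_le)
      also have "\<dots> \<le> degree G * 1" by (intro mult_left_mono) auto
      finally show "degree (smult (\<nu> j - \<mu> j) (pcompose G [:0, x j:])) \<le> D"
        using deg by (intro order_trans[OF degree_smult_le]) simp
    qed
    show "coeff g r = 0" if "r < n" for r
    proof -
      have "coeff g r = (\<Sum>j\<le>N. (\<nu> j - \<mu> j) * (x j ^ r * coeff G r))"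
        by (simp add: g_def coeff_sum coeff_pcompose_linear)
      also have "\<dots> = ((\<Sum>j\<le>N. \<nu> j * x j ^ r) - (\<Sum>j\<le>N. \<mu> j * x j ^ r)) * coeff G r"
        by (simp add: sum_distrib_right sum_subtractf left_diff_distrib mult.assoc)
      finally show ?thesis using mom[OF that] by simp
    qed
    show "\<bar>poly g t\<bar> \<le> 1" if t: "0 \<le> t" "t \<le> R" for t
    proof -
      have b: "0 \<le> poly G (t * x j)" "poly G (t * x j) \<le> 1" if "j \<le> N" for j
        using bd[of "t * x j"] mult_mono[of t R "x j" X] t x[OF that] R by auto
      have avg: "0 \<le> (\<Sum>j\<le>N. w j * poly G (t * x j)) \<and> (\<Sum>j\<le>N. w j * poly G (t * x j)) \<le> 1"
        if w: "\<And>j. 0 \<le> w j" "(\<Sum>j\<le>N. w j) = 1" for w :: "nat \<Rightarrow> real"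
      proof
        show "0 \<le> (\<Sum>j\<le>N. w j * poly G (t * x j))"
          using w b by (intro sum_nonneg mult_nonneg_nonneg) auto
        have "(\<Sum>j\<le>N. w j * poly G (t * x j)) \<le> (\<Sum>j\<le>N. w j * 1)"
          using w b by (intro sum_mono mult_left_mono) auto
        then show "(\<Sum>j\<le>N. w j * poly G (t * x j)) \<le> 1" using w by simp
      qed
      show ?thesis unfolding pg using avg[OF nn(1,3)] avg[OF nn(2,4)] by linarith
    qed
  qed
  then show ?thesis by (simp add: pg)
qed

text \<open>The functions \<open>\<beta>1\<close> and \<open>\<beta>2\<close> carry the Markov-inequality bounds on the probability that
  a random choice of \<open>b\<close> is atypical.\<close>

lemma coordinatewise_hybrid:
  fixes \<Phi> :: "(nat \<Rightarrow> nat) \<Rightarrow> real" and \<mu> \<nu> \<beta>1 \<beta>2 :: "nat \<Rightarrow> real"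
  assumes nn: "\<And>j. 0 \<le> \<mu> j" "\<And>j. 0 \<le> \<nu> j" "(\<Sum>j\<le>N. \<mu> j) = 1" "(\<Sum>j\<le>N. \<nu> j) = 1"
    and r: "(\<Sum>j\<le>N. \<nu> j * \<beta>1 j) \<le> r1" "(\<Sum>j\<le>N. \<mu> j * \<beta>2 j) \<le> r2"
    and diff: "\<And>b i. (\<And>k. b k \<le> N) \<Longrightarrow> i < m \<Longrightarrow>
      (\<Sum>j\<le>N. \<nu> j * \<Phi> (b(i := j))) - (\<Sum>j\<le>N. \<mu> j * \<Phi> (b(i := j))) \<le> \<eta>"
    and lo: "\<And>b. (\<And>k. b k \<le> N) \<Longrightarrow> c1 - (\<Sum>i<m. \<beta>1 (b i)) \<le> \<Phi> b"
    and hi: "\<And>b. (\<And>k. b k \<le> N) \<Longrightarrow> \<Phi> b \<le> c2 + (\<Sum>i<m. \<beta>2 (b i))"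
  shows "c1 - c2 \<le> real m * (r1 + r2 + \<eta>)"
  using diff lo hi
proof (induction m arbitrary: \<Phi> c1 c2)
  case 0
  from "0.prems"(2,3)[of "\<lambda>_. 0"] show ?case by simp
next
  case (Suc m)
  define \<Psi> where "\<Psi> b = (\<Sum>j\<le>N. \<nu> j * \<Phi> (b(m := j)))" for b
  have "(c1 - r1) - (c2 + r2 + \<eta>) \<le> real m * (r1 + r2 + \<eta>)"
  proof (rule Suc.IH[of \<Psi>])
    fix b :: "nat \<Rightarrow> nat" assume b: "\<And>k. b k \<le> N"
    {
      fix i assume i: "i < m"
      have "(\<Sum>j\<le>N. \<nu> j * \<Psi> (b(i := j))) - (\<Sum>j\<le>N. \<mu> j * \<Psi> (b(i := j)))
        = (\<Sum>l\<le>N. \<nu> l * ((\<Sum>j\<le>N. \<nu> j * \<Phi> (b(m := l, i := j))) - (\<Sum>j\<le>N. \<mu> j * \<Phi> (b(m := l, i := j)))))"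
      proof -
        have tw: "b(i := j, m := l) = b(m := l, i := j)" for j l using i by (auto simp: fun_upd_twist)
        have sw: "(\<Sum>j\<le>N. w j * \<Psi> (b(i := j))) = (\<Sum>l\<le>N. \<nu> l * (\<Sum>j\<le>N. w j * \<Phi> (b(m := l, i := j))))"
          for w :: "nat \<Rightarrow> real"
          unfolding \<Psi>_def tw sum_distrib_left by (subst sum.swap) (simp add: mult.left_commute)
        show ?thesis unfolding sw by (simp add: right_diff_distrib sum_subtractf)
      qed
      also have "\<dots> \<le> (\<Sum>l\<le>N. \<nu> l * \<eta>)"
        using b i nn by (intro sum_mono mult_left_mono Suc.prems(1)) auto
      also have "\<dots> = \<eta>" using nn by (simp flip: sum_distrib_right)
      finally show "(\<Sum>j\<le>N. \<nu> j * \<Psi> (b(i := j))) - (\<Sum>j\<le>N. \<mu> j * \<Psi> (b(i := j))) \<le> \<eta>" .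
    }
    have upd: "(\<Sum>i<Suc m. \<beta> ((b(m := j)) i)) = (\<Sum>i<m. \<beta> (b i)) + \<beta> j" for \<beta> :: "nat \<Rightarrow> real" and j
      by (auto intro!: sum.cong)
    have bj: "(b(m := j)) k \<le> N" if "j \<in> {..N}" for j k using b that by simp
    have "(\<Sum>j\<le>N. \<nu> j * (c1 - (\<Sum>i<m. \<beta>1 (b i)) - \<beta>1 j)) \<le> \<Psi> b"
      unfolding \<Psi>_def
    proof (intro sum_mono mult_left_mono nn)
      fix j assume jN: "j \<in> {..N}"
      show "c1 - (\<Sum>i<m. \<beta>1 (b i)) - \<beta>1 j \<le> \<Phi> (b(m := j))"
        using Suc.prems(2)[of "b(m := j)", OF bj[OF jN]] unfolding upd by (simp only: diff_diff_add)
    qed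
    also have "(\<Sum>j\<le>N. \<nu> j * (c1 - (\<Sum>i<m. \<beta>1 (b i)) - \<beta>1 j))
       = (c1 - (\<Sum>i<m. \<beta>1 (b i))) - (\<Sum>j\<le>N. \<nu> j * \<beta>1 j)"
      using nn by (simp add: right_diff_distrib sum_subtractf flip: sum_distrib_right)
    finally show "c1 - r1 - (\<Sum>i<m. \<beta>1 (b i)) \<le> \<Psi> b" using r by linarith
    have "\<Psi> b \<le> (\<Sum>j\<le>N. \<mu> j * \<Phi> (b(m := j))) + \<eta>"
      unfolding \<Psi>_def using Suc.prems(1)[of b m, OF b lessI] by linarith
    also have "(\<Sum>j\<le>N. \<mu> j * \<Phi> (b(m := j))) \<le> (\<Sum>j\<le>N. \<mu> j * (c2 + (\<Sum>i<m. \<beta>2 (b i)) + \<beta>2 j))"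
    proof (intro sum_mono mult_left_mono nn)
      fix j assume jN: "j \<in> {..N}"
      show "\<Phi> (b(m := j)) \<le> c2 + (\<Sum>i<m. \<beta>2 (b i)) + \<beta>2 j"
        using Suc.prems(3)[of "b(m := j)", OF bj[OF jN]] unfolding upd by (simp only: add.assoc)
    qed
    also have "\<dots> = (c2 + (\<Sum>i<m. \<beta>2 (b i))) + (\<Sum>j\<le>N. \<mu> j * \<beta>2 j)"
      using nn by (simp add: distrib_left sum.distrib flip: sum_distrib_right)
    finally show "\<Psi> b \<le> c2 + r2 + \<eta> + (\<Sum>i<m. \<beta>2 (b i))" using r by linarith
  qed
  then show ?case by (simp add: algebra_simps)
qed

section \<open>Queries preserve the norm\<close>

lemma sum_lessThan_mult:
  fixes f :: "nat \<Rightarrow> 'a :: comm_monoid_add"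
  shows "(\<Sum>i<m * n. f i) = (\<Sum>a<m. \<Sum>b<n. f (a * n + b))"
proof -
  have "(\<Sum>i<m * n. f i) = (\<Sum>a<m. sum f {a * n..<a * n + n})"
    by (rule sum.nat_group[symmetric])
  also have "\<dots> = (\<Sum>a<m. \<Sum>b<n. f (a * n + b))"
  proof (rule sum.cong[OF refl])
    fix a
    show "sum f {a * n..<a * n + n} = (\<Sum>b<n. f (a * n + b))"
      by (rule sum.reindex_bij_witness[of _ "\<lambda>b. a * n + b" "\<lambda>i. i - a * n"]) auto
  qed
  finally show ?thesis .
qed

lemma mat_adjoint_dim [simp]: "dim_row (mat_adjoint A) = dim_col A" "dim_col (mat_adjoint A) = dim_row A"
  by (auto simp: mat_adjoint_def)

lemma mat_adjoint_index:
  "i < dim_col A \<Longrightarrow> j < dim_row A \<Longrightarrow> mat_adjoint A $$ (i, j) = cnj (A $$ (j, i))"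
  by (simp add: mat_adjoint_def mat_of_rows_index)

lemma tensor_mat_index:
  "i < dim_row A * dim_row B \<Longrightarrow> j < dim_col A * dim_col B \<Longrightarrow> tensor_mat A B $$ (i, j) =
     A $$ (i div dim_row B, j div dim_col B) * B $$ (i mod dim_row B, j mod dim_col B)"
  by (simp add: tensor_mat_def)

lemma tensor_mat_dim [simp]:
  "dim_row (tensor_mat A B) = dim_row A * dim_row B" "dim_col (tensor_mat A B) = dim_col A * dim_col B"
  by (simp_all add: tensor_mat_def)

definition orthonormal_cols :: "nat \<Rightarrow> (nat \<Rightarrow> nat \<Rightarrow> complex) \<Rightarrow> bool" where
  "orthonormal_cols n Q \<longleftrightarrow>
     (\<forall>j<n. \<forall>k<n. (\<Sum>i<n. cnj (Q i j) * Q i k) = of_bool (j = k))"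

lemma unitary_orthonormal_cols:
  assumes "unitary_mat n U"
  shows "orthonormal_cols n (\<lambda>i j. U $$ (i, j))"
  unfolding orthonormal_cols_def
proof (intro allI impI)
  fix j k assume jk: "j < n" "k < n"
  have U: "U \<in> carrier_mat n n" "mat_adjoint U * U = 1\<^sub>m n" using assms by (auto simp: unitary_mat_def)
  have "(\<Sum>i<n. cnj (U $$ (i, j)) * U $$ (i, k)) = (mat_adjoint U * U) $$ (j, k)"
    using jk U(1) by (auto simp: scalar_prod_def mat_adjoint_index atLeast0LessThan intro!: sum.cong)
  also have "\<dots> = of_bool (j = k)"
    using jk by (simp add: U(2))
  finally show "(\<Sum>i<n. cnj (U $$ (i, j)) * U $$ (i, k)) = of_bool (j = k)" .
qed

lemma orthonormal_cols_tensor: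
  assumes A: "orthonormal_cols m A" and B: "orthonormal_cols n B"
  shows "orthonormal_cols (m * n) (\<lambda>i j. A (i div n) (j div n) * B (i mod n) (j mod n))"
  unfolding orthonormal_cols_def
proof (intro allI impI)
  fix j k assume jk: "j < m * n" "k < m * n"
  then have n: "0 < n" by (cases n) auto
  have d: "j div n < m" "k div n < m" "j mod n < n" "k mod n < n"
    using jk n by (auto simp: less_mult_imp_div_less)
  have "(\<Sum>i<m * n. cnj (A (i div n) (j div n) * B (i mod n) (j mod n)) * (A (i div n) (k div n) * B (i mod n) (k mod n)))
     = (\<Sum>a<m. \<Sum>b<n. (cnj (A a (j div n)) * A a (k div n)) * (cnj (B b (j mod n)) * B b (k mod n)))"
    unfolding sum_lessThan_mult by (intro sum.cong refl) (use n in auto)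
  also have "\<dots> = (\<Sum>a<m. cnj (A a (j div n)) * A a (k div n)) * (\<Sum>b<n. cnj (B b (j mod n)) * B b (k mod n))"
    by (simp add: sum_product)
  also have "\<dots> = of_bool (j div n = k div n) * of_bool (j mod n = k mod n)"
    using A B d by (simp add: orthonormal_cols_def)
  also have "\<dots> = of_bool (j = k)"
    by (auto simp flip: of_bool_conj) (metis div_mult_mod_eq)
  finally show "(\<Sum>i<m * n. cnj (A (i div n) (j div n) * B (i mod n) (j mod n)) *
      (A (i div n) (k div n) * B (i mod n) (k mod n))) = of_bool (j = k)" .
qed

lemma orthonormal_cols_block:
  assumes E: "\<And>c. c < m \<Longrightarrow> orthonormal_cols n (E c)"
  shows "orthonormal_cols (m * n)
    (\<lambda>i j. if i div n = j div n then E (i div n) (i mod n) (j mod n) else 0)"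
  unfolding orthonormal_cols_def
proof (intro allI impI)
  fix j k assume jk: "j < m * n" "k < m * n"
  then have n: "0 < n" by (cases n) auto
  have d: "j div n < m" "k div n < m" "j mod n < n" "k mod n < n"
    using jk n by (auto simp: less_mult_imp_div_less)
  have "(\<Sum>i<m * n. cnj (if i div n = j div n then E (i div n) (i mod n) (j mod n) else 0) *
          (if i div n = k div n then E (i div n) (i mod n) (k mod n) else 0))
     = (\<Sum>a<m. if a = j div n then of_bool (j div n = k div n) *
          (\<Sum>b<n. cnj (E (j div n) b (j mod n)) * E (j div n) b (k mod n)) else 0)"
    unfolding sum_lessThan_mult by (intro sum.cong refl) (use n in auto)
  also have "\<dots> = of_bool (j div n = k div n) * of_bool (j mod n = k mod n)"
    using E[OF d(1)] d by (simp add: orthonormal_cols_def)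
  also have "\<dots> = of_bool (j = k)"
    by (auto simp flip: of_bool_conj) (metis div_mult_mod_eq)
  finally show "(\<Sum>i<m * n. cnj (if i div n = j div n then E (i div n) (i mod n) (j mod n) else 0) *
          (if i div n = k div n then E (i div n) (i mod n) (k mod n) else 0)) = of_bool (j = k)" .
qed

lemma orthonormal_cols_delta: "orthonormal_cols n (\<lambda>i j. of_bool (i = j))"
  unfolding orthonormal_cols_def
proof (intro allI impI)
  fix j k assume "j < n" "k < n"
  have "(\<Sum>i<n. cnj (of_bool (i = j)) * of_bool (i = k) :: complex) = (\<Sum>i<n. if i = j then of_bool (j = k) else 0)"
    by (intro sum.cong) auto
  then show "(\<Sum>i<n. cnj (of_bool (i = j)) * of_bool (i = k) :: complex) = of_bool (j = k)"
    using \<open>j < n\<close> by simp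
qed

lemma orthonormal_cols_norm:
  assumes Q: "Q \<in> carrier_mat n n" "orthonormal_cols n (\<lambda>i j. Q $$ (i, j))" and v: "v \<in> carrier_vec n"
  shows "(\<Sum>i<n. (cmod ((Q *\<^sub>v v) $ i))\<^sup>2) = (\<Sum>i<n. (cmod (v $ i))\<^sup>2)"
proof -
  have "complex_of_real (\<Sum>i<n. (cmod ((Q *\<^sub>v v) $ i))\<^sup>2) = (\<Sum>i<n. cnj ((Q *\<^sub>v v) $ i) * (Q *\<^sub>v v) $ i)"
    unfolding of_real_sum complex_norm_square by (simp add: mult.commute)
  also have "\<dots> = (\<Sum>i<n. cnj (\<Sum>j<n. Q $$ (i, j) * v $ j) * (\<Sum>k<n. Q $$ (i, k) * v $ k))"
    using Q(1) v by (intro sum.cong refl) (auto simp: scalar_prod_def atLeast0LessThan)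
  also have "\<dots> = (\<Sum>i<n. \<Sum>j<n. \<Sum>k<n. cnj (v $ j) * v $ k * (cnj (Q $$ (i, j)) * Q $$ (i, k)))"
    unfolding cnj_sum sum_product by (intro sum.cong refl) (simp add: mult_ac)
  also have "\<dots> = (\<Sum>j<n. \<Sum>k<n. \<Sum>i<n. cnj (v $ j) * v $ k * (cnj (Q $$ (i, j)) * Q $$ (i, k)))"
    by (rule trans[OF sum.swap], rule sum.cong[OF refl], rule sum.swap)
  also have "\<dots> = (\<Sum>j<n. \<Sum>k<n. if k = j then cnj (v $ j) * v $ k else 0)"
    using Q(2) by (intro sum.cong refl) (auto simp: orthonormal_cols_def simp flip: sum_distrib_left)
  also have "\<dots> = (\<Sum>j<n. v $ j * cnj (v $ j))"
    by (intro sum.cong refl) (simp add: mult.commute)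
  also have "\<dots> = complex_of_real (\<Sum>i<n. (cmod (v $ i))\<^sup>2)"
    unfolding of_real_sum complex_norm_square by simp
  finally show ?thesis by (simp only: of_real_eq_iff)
qed

definition query_entry :: "complex mat \<Rightarrow> nat \<Rightarrow> nat \<Rightarrow> nat \<Rightarrow> nat \<Rightarrow> nat \<Rightarrow> complex" where
  "query_entry U w q c i j =
     (if q \<le> 1 \<or> c = 1 then U $$ (i div w, j div w) * of_bool (i mod w = j mod w) else of_bool (i = j))"

lemma query_op_index:
  assumes U: "U \<in> carrier_mat n n" "mat_adjoint U = U"
    and ij: "i < 2 * (n * w)" "j < 2 * (n * w)"
  shows "query_op w U q $$ (i, j) =
    (if i div (n * w) = j div (n * w)
     then query_entry U w q (i div (n * w)) (i mod (n * w)) (j mod (n * w)) else 0)"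
proof -
  define M where "M = n * w"
  have M: "0 < M" using ij by (auto simp: M_def intro: Nat.gr0I)
  then have w: "0 < w" by (simp add: M_def)
  have c: "i div M < 2" "j div M < 2" using ij by (auto simp: M_def less_mult_imp_div_less)
  have r: "i mod M < M" "j mod M < M" using M by auto
  then have rw: "i mod M div w < n" "j mod M div w < n" "i mod M mod w < w" "j mod M mod w < w"
    using w by (auto simp: M_def less_mult_imp_div_less)
  have dim: "dim_row U = n" "dim_col U = n" using U by auto
  have X: "tensor_mat U (1\<^sub>m w) $$ (i mod M, j mod M) = U $$ (i mod M div w, j mod M div w) * of_bool (i mod M mod w = j mod M mod w)"
  proof -
    have "i mod M < dim_row U * dim_row (1\<^sub>m w)" "j mod M < dim_col U * dim_col (1\<^sub>m w)"
      using r by (simp_all add: dim flip: M_def)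
    from tensor_mat_index[OF this] show ?thesis using rw by simp
  qed
  show ?thesis
  proof (cases "q \<le> 1")
    case True
    have "query_op w U q $$ (i, j) = tensor_mat (1\<^sub>m 2) (tensor_mat U (1\<^sub>m w)) $$ (i, j)"
      using True U(2) by (simp add: query_op_def)
    also have "\<dots> = 1\<^sub>m 2 $$ (i div M, j div M) * tensor_mat U (1\<^sub>m w) $$ (i mod M, j mod M)"
      using ij by (subst tensor_mat_index) (auto simp: dim simp flip: M_def)
    also have "\<dots> = (if i div M = j div M then query_entry U w q (i div M) (i mod M) (j mod M) else 0)"
      unfolding X using c True by (simp add: query_entry_def)
    finally show ?thesis by (simp add: M_def)
  next
    case False
    define P0 :: "complex mat" where "P0 = mat 2 2 (\<lambda>(i, j). if i = 0 \<and> j = 0 then 1 else 0)"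
    define P1 :: "complex mat" where "P1 = mat 2 2 (\<lambda>(i, j). if i = 1 \<and> j = 1 then 1 else 0)"
    have d: "dim_row P0 = 2" "dim_col P0 = 2" "dim_row P1 = 2" "dim_col P1 = 2" by (auto simp: P0_def P1_def)
    have "query_op w U q $$ (i, j) = (tensor_mat P0 (1\<^sub>m M) + tensor_mat P1 (tensor_mat U (1\<^sub>m w))) $$ (i, j)"
      using False U(2) by (simp add: query_op_def P0_def P1_def M_def dim Let_def)
    also have "\<dots> = tensor_mat P0 (1\<^sub>m M) $$ (i, j) + tensor_mat P1 (tensor_mat U (1\<^sub>m w)) $$ (i, j)"
      using ij by (intro index_add_mat) (auto simp: d dim)
    also have "tensor_mat P0 (1\<^sub>m M) $$ (i, j) = P0 $$ (i div M, j div M) * of_bool (i mod M = j mod M)"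
      using ij r by (subst tensor_mat_index) (auto simp: d simp flip: M_def)
    also have "tensor_mat P1 (tensor_mat U (1\<^sub>m w)) $$ (i, j) = P1 $$ (i div M, j div M) * tensor_mat U (1\<^sub>m w) $$ (i mod M, j mod M)"
      using ij by (subst tensor_mat_index) (auto simp: d dim simp flip: M_def)
    also have "P0 $$ (i div M, j div M) * of_bool (i mod M = j mod M) + P1 $$ (i div M, j div M) * tensor_mat U (1\<^sub>m w) $$ (i mod M, j mod M)
      = (if i div M = j div M then query_entry U w q (i div M) (i mod M) (j mod M) else 0)"
      unfolding X P0_def P1_def using c False by (auto simp: query_entry_def less_2_cases_iff)
    finally show ?thesis by (simp add: M_def)
  qed
qed

lemma query_op_carrier:
  assumes "U \<in> carrier_mat n n"
  shows "query_op w U q \<in> carrier_mat (2 * (n * w)) (2 * (n * w))"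
  using assms by (intro carrier_matI) (simp_all add: query_op_def Let_def)

lemma query_op_orthonormal:
  assumes U: "unitary_mat n U" "mat_adjoint U = U"
  shows "orthonormal_cols (2 * (n * w)) (\<lambda>i j. query_op w U q $$ (i, j))"
proof -
  have Uc: "U \<in> carrier_mat n n" using U by (simp add: unitary_mat_def)
  have "orthonormal_cols (n * w) (query_entry U w q c)" for c
    unfolding query_entry_def
    using orthonormal_cols_tensor[OF unitary_orthonormal_cols[OF U(1)] orthonormal_cols_delta[of w]]
      orthonormal_cols_delta[of "n * w"] by (cases "q \<le> 1 \<or> c = 1") auto
  then have "orthonormal_cols (2 * (n * w))
    (\<lambda>i j. if i div (n * w) = j div (n * w)
     then query_entry U w q (i div (n * w)) (i mod (n * w)) (j mod (n * w)) else 0)"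
    by (rule orthonormal_cols_block)
  then show ?thesis
    unfolding orthonormal_cols_def by (simp add: query_op_index[OF Uc U(2)] cong: sum.cong_simp)
qed

lemma run_alg_carrier_norm:
  assumes U: "unitary_mat n U" "mat_adjoint U = U"
  shows "length Vs = Suc (length qs) \<Longrightarrow> (\<forall>V\<in>set Vs. unitary_mat (2 * (n * w)) V) \<Longrightarrow>
    s \<in> carrier_vec (2 * (n * w)) \<Longrightarrow>
    run_alg w U Vs qs s \<in> carrier_vec (2 * (n * w)) \<and>
    (\<Sum>i<2 * (n * w). (cmod (run_alg w U Vs qs s $ i))\<^sup>2) = (\<Sum>i<2 * (n * w). (cmod (s $ i))\<^sup>2)"
proof (induction qs arbitrary: Vs s)
  case Nil
  then obtain V where V: "Vs = [V]" by (cases Vs) auto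
  with Nil have "unitary_mat (2 * (n * w)) V" by simp
  then have "V \<in> carrier_mat (2 * (n * w)) (2 * (n * w))" "orthonormal_cols (2 * (n * w)) (\<lambda>i j. V $$ (i, j))"
    using unitary_orthonormal_cols by (auto simp: unitary_mat_def)
  with Nil V show ?case using orthonormal_cols_norm by auto
next
  case (Cons q qs)
  obtain V V' Vs' where Vs: "Vs = V # V' # Vs'" using Cons.prems(1) by (cases Vs; cases "tl Vs") auto
  have "unitary_mat (2 * (n * w)) V" using Cons.prems Vs by simp
  then have V: "V \<in> carrier_mat (2 * (n * w)) (2 * (n * w))" "orthonormal_cols (2 * (n * w)) (\<lambda>i j. V $$ (i, j))"
    using unitary_orthonormal_cols by (auto simp: unitary_mat_def)
  have Q: "query_op w U q \<in> carrier_mat (2 * (n * w)) (2 * (n * w))"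
    using U by (intro query_op_carrier) (simp add: unitary_mat_def)
  have s1: "V *\<^sub>v s \<in> carrier_vec (2 * (n * w))" using V Cons.prems by auto
  have s2: "query_op w U q *\<^sub>v (V *\<^sub>v s) \<in> carrier_vec (2 * (n * w))" using Q s1 by auto
  show ?case
    using Cons.IH[of "V' # Vs'" "query_op w U q *\<^sub>v (V *\<^sub>v s)"] Cons.prems Vs s2
      orthonormal_cols_norm[OF Q query_op_orthonormal[OF U] s1] orthonormal_cols_norm[OF V Cons.prems(3)]
    by simp
qed

section \<open>Averaging over signs\<close>

definition ypoly :: "nat \<Rightarrow> nat \<Rightarrow> ((nat \<Rightarrow> real) \<Rightarrow> complex) \<Rightarrow> bool" where
  "ypoly d D f \<longleftrightarrow> (\<exists>ms :: (complex \<times> nat list) list.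
     (\<forall>(c, l)\<in>set ms. length l \<le> D \<and> set l \<subseteq> {..<d}) \<and>
     f = (\<lambda>y. \<Sum>(c, l)\<leftarrow>ms. c * of_real (prod_list (map y l))))"

lemma ypoly_const: "ypoly d D (\<lambda>_. c)"
  unfolding ypoly_def by (rule exI[of _ "[(c, [])]"]) simp

lemma ypoly_var: "i < d \<Longrightarrow> 1 \<le> D \<Longrightarrow> ypoly d D (\<lambda>y. of_real (y i))"
  unfolding ypoly_def by (rule exI[of _ "[(1, [i])]"]) simp

lemma ypoly_add:
  assumes "ypoly d D f" "ypoly d D g"
  shows "ypoly d D (\<lambda>y. f y + g y)"
proof -
  obtain ms ns where
    "\<forall>(c, l)\<in>set ms. length l \<le> D \<and> set l \<subseteq> {..<d}" "f = (\<lambda>y. \<Sum>(c, l)\<leftarrow>ms. c * of_real (prod_list (map y l)))"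
    "\<forall>(c, l)\<in>set ns. length l \<le> D \<and> set l \<subseteq> {..<d}" "g = (\<lambda>y. \<Sum>(c, l)\<leftarrow>ns. c * of_real (prod_list (map y l)))"
    using assms unfolding ypoly_def by blast
  then show ?thesis
    unfolding ypoly_def by (intro exI[of _ "ms @ ns"]) auto
qed

lemma ypoly_mult:
  assumes "ypoly d D f" "ypoly d E g"
  shows "ypoly d (D + E) (\<lambda>y. f y * g y)"
proof -
  obtain ms ns where
    ms: "\<forall>(c, l)\<in>set ms. length l \<le> D \<and> set l \<subseteq> {..<d}" "f = (\<lambda>y. \<Sum>(c, l)\<leftarrow>ms. c * of_real (prod_list (map y l)))"
    and ns: "\<forall>(c, l)\<in>set ns. length l \<le> E \<and> set l \<subseteq> {..<d}" "g = (\<lambda>y. \<Sum>(c, l)\<leftarrow>ns. c * of_real (prod_list (map y l)))"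
    using assms unfolding ypoly_def by blast
  define ps where "ps = concat (map (\<lambda>(c, l). map (\<lambda>(c', l'). (c * c', l @ l')) ns) ms)"
  have "\<forall>(c, l)\<in>set ps. length l \<le> D + E \<and> set l \<subseteq> {..<d}"
    using ms(1) ns(1) unfolding ps_def by (fastforce intro: add_mono)
  moreover have "(\<Sum>(c, l)\<leftarrow>ps. c * of_real (prod_list (map y l))) = f y * g y" for y
  proof -
    have one: "(\<Sum>(c', l')\<leftarrow>map (\<lambda>(c', l'). (c * c', l @ l')) ns. c' * of_real (prod_list (map y l')))
      = c * of_real (prod_list (map y l)) * g y" for c and l :: "nat list"
      unfolding ns(2) by (induction ns) (auto simp: algebra_simps)
    show ?thesis
      unfolding ps_def ms(2) by (induction ms) (auto simp: one distrib_right simp del: map_map)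
  qed
  ultimately show ?thesis unfolding ypoly_def by (intro exI[of _ ps]) auto
qed

lemma ypoly_sum:
  assumes "\<And>i. i \<in> A \<Longrightarrow> ypoly d D (f i)"
  shows "ypoly d D (\<lambda>y. \<Sum>i\<in>A. f i y)"
  using assms by (induction A rule: infinite_finite_induct) (auto intro: ypoly_const ypoly_add)

lemma ypoly_cnj:
  assumes "ypoly d D f"
  shows "ypoly d D (\<lambda>y. cnj (f y))"
proof -
  obtain ms where
    ms: "\<forall>(c, l)\<in>set ms. length l \<le> D \<and> set l \<subseteq> {..<d}" "f = (\<lambda>y. \<Sum>(c, l)\<leftarrow>ms. c * of_real (prod_list (map y l)))"
    using assms unfolding ypoly_def by blast
  have "cnj (f y) = (\<Sum>(c, l)\<leftarrow>map (\<lambda>(c, l). (cnj c, l)) ms. c * of_real (prod_list (map y l)))" for y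
    unfolding ms(2) by (induction ms) auto
  then show ?thesis unfolding ypoly_def using ms(1)
    by (intro exI[of _ "map (\<lambda>(c, l). (cnj c, l)) ms"]) fastforce
qed

definition flip_signs :: "nat set \<Rightarrow> (nat \<Rightarrow> real) \<Rightarrow> nat \<Rightarrow> real" where
  "flip_signs S y i = (if i \<in> S then - y i else y i)"

text \<open>A variable occurring exactly once in the monomial is killed by the average; a repeated one
  contributes the square of a square root.\<close>

lemma sign_average_monomial:
  assumes "set l \<subseteq> {..<d}"
  shows "\<exists>G. degree G \<le> length l div 2 \<and> (\<forall>t. (\<forall>i<d. 0 \<le> a i + t * b i) \<longrightarrow>
     (\<Sum>S\<in>Pow {..<d}. prod_list (map (flip_signs S (\<lambda>i. sqrt (a i + t * b i))) l)) = poly G t)"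
  using assms
proof (induction "length l" arbitrary: l rule: less_induct)
  case less
  show ?case
  proof (cases l)
    case Nil
    then show ?thesis by (intro exI[of _ "[:2 ^ d:]"]) (simp add: card_Pow)
  next
    case (Cons i l')
    have i: "i < d" using less.prems Cons by auto
    show ?thesis
    proof (cases "i \<in> set l'")
      case True
      define l'' where "l'' = remove1 i l'"
      have len: "length l' = Suc (length l'')"
        using True by (simp add: l''_def length_remove1) (metis Suc_pred length_pos_if_in_set)
      have "set l'' \<subseteq> {..<d}" using less.prems Cons set_remove1_subset[of i l'] by (auto simp: l''_def)
      then obtain G where G: "degree G \<le> length l'' div 2"
        "\<And>t. (\<forall>i<d. 0 \<le> a i + t * b i) \<Longrightarrow>
          (\<Sum>S\<in>Pow {..<d}. prod_list (map (flip_signs S (\<lambda>i. sqrt (a i + t * b i))) l'')) = poly G t"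
        using less.hyps[of l''] len Cons by auto
      have pr: "prod_list (map f l) = (f i)\<^sup>2 * prod_list (map f l'')" for f :: "nat \<Rightarrow> real"
      proof -
        have "prod_list (map f l') = f i * prod_list (map f (remove1 i l'))"
          using True by (induction l') auto
        then show ?thesis using Cons by (simp add: l''_def power2_eq_square)
      qed
      have sq: "(flip_signs S f i)\<^sup>2 = (f i)\<^sup>2" for S f by (simp add: flip_signs_def)
      show ?thesis
      proof (intro exI[of _ "[:a i, b i:] * G"] conjI allI impI)
        have "degree ([:a i, b i:] * G) \<le> degree [:a i, b i:] + degree G" by (rule degree_mult_le)
        also have "\<dots> \<le> 1 + length l'' div 2" using G(1) by (intro add_mono) auto
        also have "\<dots> = length l div 2" using Cons len by simp
        finally show "degree ([:a i, b i:] * G) \<le> length l div 2" .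
        fix t assume t: "\<forall>i<d. 0 \<le> a i + t * b i"
        then show "(\<Sum>S\<in>Pow {..<d}. prod_list (map (flip_signs S (\<lambda>i. sqrt (a i + t * b i))) l))
            = poly ([:a i, b i:] * G) t"
          unfolding pr sq using G(2)[OF t] i by (simp add: distrib_right mult.assoc flip: sum_distrib_left)
      qed
    next
      case False
      have "(\<Sum>S\<in>Pow {..<d}. prod_list (map (flip_signs S y) l)) = 0" for y :: "nat \<Rightarrow> real"
      proof -
        define T where "T S = (if i \<in> S then S - {i} else insert i S)" for S :: "nat set"
        have TT: "T (T S) = S" for S by (auto simp: T_def)
        have TP: "j < d" if "S \<subseteq> {..<d}" "j \<in> T S" for S j
          using that i by (auto simp: T_def split: if_splits)
        have neg: "prod_list (map (flip_signs (T S) y) l) = - prod_list (map (flip_signs S y) l)" for S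
        proof -
          have "map (flip_signs (T S) y) l' = map (flip_signs S y) l'"
            using False by (intro map_cong refl) (auto simp: T_def flip_signs_def)
          moreover have "flip_signs (T S) y i = - flip_signs S y i"
            by (simp add: T_def flip_signs_def)
          ultimately show ?thesis unfolding Cons by (simp only: list.map prod_list.Cons mult_minus_left)
        qed
        have "(\<Sum>S\<in>Pow {..<d}. prod_list (map (flip_signs S y) l))
          = (\<Sum>S\<in>Pow {..<d}. prod_list (map (flip_signs (T S) y) l))"
          using i by (intro sum.reindex_bij_witness[of _ T T]) (auto simp: TT TP)
        then show ?thesis unfolding neg by (simp add: sum_negf)
      qed
      then show ?thesis by (intro exI[of _ 0]) simp
    qed
  qed
qed

lemma sign_average_ypoly:
  assumes f: "ypoly d (2 * D) (\<lambda>y. complex_of_real (f y))"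
  shows "\<exists>G. degree G \<le> D \<and> (\<forall>t. (\<forall>i<d. 0 \<le> a i + t * b i) \<longrightarrow>
     (\<Sum>S\<in>Pow {..<d}. f (flip_signs S (\<lambda>i. sqrt (a i + t * b i)))) = poly G t)"
proof -
  obtain ms where
    ms: "\<forall>(c, l)\<in>set ms. length l \<le> 2 * D \<and> set l \<subseteq> {..<d}"
    and fc: "(\<lambda>y. complex_of_real (f y)) = (\<lambda>y. \<Sum>(c, l)\<leftarrow>ms. c * of_real (prod_list (map y l)))"
    using f unfolding ypoly_def by blast
  have "f y = (\<Sum>(c, l)\<leftarrow>ms. Re c * prod_list (map y l))" for y
  proof -
    have "f y = Re (\<Sum>(c, l)\<leftarrow>ms. c * of_real (prod_list (map y l)))"
      using fun_cong[OF fc, of y] by (metis Re_complex_of_real)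
    also have "\<dots> = (\<Sum>(c, l)\<leftarrow>ms. Re c * prod_list (map y l))" by (induction ms) auto
    finally show ?thesis .
  qed
  moreover have "\<exists>G. degree G \<le> D \<and> (\<forall>t. (\<forall>i<d. 0 \<le> a i + t * b i) \<longrightarrow>
     (\<Sum>S\<in>Pow {..<d}. \<Sum>(c, l)\<leftarrow>ms. Re c * prod_list (map (flip_signs S (\<lambda>i. sqrt (a i + t * b i))) l)) = poly G t)"
    using ms
  proof (induction ms)
    case Nil
    show ?case by (intro exI[of _ 0]) simp
  next
    case (Cons m ms)
    obtain c l where m: "m = (c, l)" by (cases m)
    obtain G where G: "degree G \<le> D" "\<And>t. (\<forall>i<d. 0 \<le> a i + t * b i) \<Longrightarrow>
       (\<Sum>S\<in>Pow {..<d}. \<Sum>(c, l)\<leftarrow>ms. Re c * prod_list (map (flip_signs S (\<lambda>i. sqrt (a i + t * b i))) l)) = poly G t"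
      using Cons by auto
    obtain G' where G': "degree G' \<le> length l div 2" "\<And>t. (\<forall>i<d. 0 \<le> a i + t * b i) \<Longrightarrow>
       (\<Sum>S\<in>Pow {..<d}. prod_list (map (flip_signs S (\<lambda>i. sqrt (a i + t * b i))) l)) = poly G' t"
      using sign_average_monomial[of l d a b] Cons.prems m by auto
    have l: "length l div 2 \<le> D" using Cons.prems m by auto
    show ?case
    proof (intro exI[of _ "smult (Re c) G' + G"] conjI allI impI)
      show "degree (smult (Re c) G' + G) \<le> D"
        using G(1) G'(1) l by (intro degree_add_le order_trans[OF degree_smult_le]) auto
      fix t assume t: "\<forall>i<d. 0 \<le> a i + t * b i"
      show "(\<Sum>S\<in>Pow {..<d}. \<Sum>(c, l)\<leftarrow>m # ms. Re c * prod_list (map (flip_signs S (\<lambda>i. sqrt (a i + t * b i))) l))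
          = poly (smult (Re c) G' + G) t"
        using G(2)[OF t] G'(2)[OF t] by (simp add: m sum.distrib flip: sum_distrib_left)
    qed
  qed
  ultimately show ?thesis by simp
qed

definition ystate :: "nat \<Rightarrow> nat \<Rightarrow> nat \<Rightarrow> ((nat \<Rightarrow> real) \<Rightarrow> complex vec) \<Rightarrow> bool" where
  "ystate d N D s \<longleftrightarrow> (\<forall>y. s y \<in> carrier_vec N) \<and> (\<forall>i<N. ypoly d D (\<lambda>y. s y $ i))"

lemma ystate_mult:
  assumes M: "\<And>y. M y \<in> carrier_mat N N" "\<And>i j. i < N \<Longrightarrow> j < N \<Longrightarrow> ypoly d E (\<lambda>y. M y $$ (i, j))"
    and s: "ystate d N D s"
  shows "ystate d N (E + D) (\<lambda>y. M y *\<^sub>v s y)"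
  unfolding ystate_def
proof (intro conjI allI impI)
  have sc: "s y \<in> carrier_vec N" for y using s by (simp add: ystate_def)
  show "M y *\<^sub>v s y \<in> carrier_vec N" for y using M(1)[of y] sc[of y] by auto
  fix i assume i: "i < N"
  have "(M y *\<^sub>v s y) $ i = (\<Sum>j<N. M y $$ (i, j) * s y $ j)" for y
    using M(1)[of y] sc[of y] i by (auto simp: scalar_prod_def atLeast0LessThan intro!: sum.cong)
  then show "ypoly d (E + D) (\<lambda>y. (M y *\<^sub>v s y) $ i)"
    using s i by (auto simp: ystate_def intro!: ypoly_sum ypoly_mult M(2))
qed

lemma ystate_query:
  assumes U: "\<And>y. U y \<in> carrier_mat n n" "\<And>y. mat_adjoint (U y) = U y"
    and e: "\<And>i j. i < n \<Longrightarrow> j < n \<Longrightarrow> ypoly d E (\<lambda>y. U y $$ (i, j))"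
    and s: "ystate d (2 * (n * w)) D s"
  shows "ystate d (2 * (n * w)) (E + D) (\<lambda>y. query_op w (U y) q *\<^sub>v s y)"
proof (rule ystate_mult[OF query_op_carrier[OF U(1)] _ s])
  fix i j assume ij: "i < 2 * (n * w)" "j < 2 * (n * w)"
  then have nw: "0 < n * w" "0 < w" by (auto intro: Nat.gr0I)
  have d: "(k mod (n * w)) div w < n" for k
    using nw by (intro less_mult_imp_div_less) simp
  have "ypoly d E (\<lambda>y. query_entry (U y) w q c (i mod (n * w)) (j mod (n * w)))" for c
    unfolding query_entry_def
    using ypoly_mult[OF e[OF d d] ypoly_const[of d 0]] ypoly_const
    by (cases "q \<le> 1 \<or> c = 1") simp_all
  then show "ypoly d E (\<lambda>y. query_op w (U y) q $$ (i, j))"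
    unfolding query_op_index[OF U ij]
    by (cases "i div (n * w) = j div (n * w)") (simp_all add: ypoly_const)
qed

lemma ystate_run_alg:
  assumes U: "\<And>y. U y \<in> carrier_mat n n" "\<And>y. mat_adjoint (U y) = U y"
    and e: "\<And>i j. i < n \<Longrightarrow> j < n \<Longrightarrow> ypoly d E (\<lambda>y. U y $$ (i, j))"
  shows "length Vs = Suc (length qs) \<Longrightarrow> (\<forall>V\<in>set Vs. V \<in> carrier_mat (2 * (n * w)) (2 * (n * w))) \<Longrightarrow>
    ystate d (2 * (n * w)) D s \<Longrightarrow>
    ystate d (2 * (n * w)) (length qs * E + D) (\<lambda>y. run_alg w (U y) Vs qs (s y))"
proof (induction qs arbitrary: Vs s D)
  case Nil
  then obtain V where V: "Vs = [V]" by (cases Vs) auto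
  with Nil have "V \<in> carrier_mat (2 * (n * w)) (2 * (n * w))" by simp
  from ystate_mult[OF this ypoly_const[of _ 0] Nil.prems(3)] show ?case using V by simp
next
  case (Cons q qs)
  obtain V V' Vs' where Vs: "Vs = V # V' # Vs'" using Cons.prems(1) by (cases Vs; cases "tl Vs") auto
  then have "V \<in> carrier_mat (2 * (n * w)) (2 * (n * w))" using Cons.prems by simp
  from ystate_query[OF U e ystate_mult[OF this ypoly_const[of _ 0] Cons.prems(3)], of q]
  have "ystate d (2 * (n * w)) (E + D) (\<lambda>y. query_op w (U y) q *\<^sub>v (V *\<^sub>v s y))" by simp
  from Cons.IH[of "V' # Vs'", OF _ _ this] show ?case
    using Cons.prems Vs by (simp add: add_ac)
qed

section \<open>Reflection oracles and the polynomial method\<close>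

text \<open>The axis is \<open>(|0>|0> - \<Sum>i. y i |i>|i+1>) / sqrt 2\<close>: the reflection along it exchanges
  \<open>|0>|0>\<close> with the state \<open>\<Sum>i. y i |i>|i+1>\<close>, which is orthogonal to \<open>|0>|0>\<close>.\<close>

definition reflection_axis :: "nat \<Rightarrow> (nat \<Rightarrow> real) \<Rightarrow> nat \<Rightarrow> real" where
  "reflection_axis k y a = (if a = 0 then 1 / sqrt 2
     else if a mod k = Suc (a div k) then - y (a div k) / sqrt 2 else 0)"

definition reflection_oracle :: "nat \<Rightarrow> (nat \<Rightarrow> real) \<Rightarrow> complex mat" where
  "reflection_oracle d y = mat (d * Suc d) (d * Suc d) (\<lambda>(i, j).
     of_real (of_bool (i = j) - 2 * reflection_axis (Suc d) y i * reflection_axis (Suc d) y j))"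

lemma reflection_oracle_carrier: "reflection_oracle d y \<in> carrier_mat (d * Suc d) (d * Suc d)"
  by (simp add: reflection_oracle_def)

lemma reflection_oracle_hermitian: "mat_adjoint (reflection_oracle d y) = reflection_oracle d y"
  by (rule eq_matI) (auto simp: mat_adjoint_index reflection_oracle_def)

lemma reflection_axis_norm:
  assumes y: "(\<Sum>i<d. (y i)\<^sup>2) = 1" and d: "0 < d"
  shows "(\<Sum>a<d * Suc d. (reflection_axis (Suc d) y a)\<^sup>2) = 1"
proof -
  have "(\<Sum>b<Suc d. (reflection_axis (Suc d) y (i * Suc d + b))\<^sup>2) = of_bool (i = 0) / 2 + (y i)\<^sup>2 / 2"
    if i: "i < d" for i
  proof -
    have "(reflection_axis (Suc d) y (i * Suc d + b))\<^sup>2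
        = (if b = 0 then of_bool (i = 0) / 2 else 0) + (if b = Suc i then (y i)\<^sup>2 / 2 else 0)"
      if b: "b < Suc d" for b
    proof -
      have "(i * Suc d + b) mod Suc d = b" "(i * Suc d + b) div Suc d = i"
        using b div_mult_self3[of "Suc d" i b] by (auto simp del: mult_Suc_right)
      then show ?thesis unfolding reflection_axis_def by (auto simp: power_divide)
    qed
    then have "(\<Sum>b<Suc d. (reflection_axis (Suc d) y (i * Suc d + b))\<^sup>2)
      = (\<Sum>b<Suc d. (if b = 0 then of_bool (i = 0) / 2 else 0) + (if b = Suc i then (y i)\<^sup>2 / 2 else 0))"
      by (intro sum.cong) auto
    also have "\<dots> = of_bool (i = 0) / 2 + (y i)\<^sup>2 / 2"
      using i unfolding sum.distrib by (simp add: sum.delta del: sum.lessThan_Suc)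
    finally show ?thesis .
  qed
  then have "(\<Sum>a<d * Suc d. (reflection_axis (Suc d) y a)\<^sup>2) = (\<Sum>i<d. of_bool (i = 0) / 2 + (y i)\<^sup>2 / 2)"
    unfolding sum_lessThan_mult by (intro sum.cong) auto
  also have "\<dots> = (\<Sum>i<d. if i = 0 then 1 / 2 else 0) + (\<Sum>i<d. (y i)\<^sup>2) / 2"
    unfolding sum.distrib sum_divide_distrib by (intro arg_cong2[of _ _ _ _ "(+)"] sum.cong) auto
  also have "\<dots> = 1" using d y by simp
  finally show ?thesis .
qed

lemma reflection_oracle_unitary:
  assumes y: "(\<Sum>i<d. (y i)\<^sup>2) = 1" and d: "0 < d"
  shows "unitary_mat (d * Suc d) (reflection_oracle d y)"
proof -
  define N where "N = d * Suc d"
  define u where "u = reflection_axis (Suc d) y"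
  have un: "(\<Sum>a<N. (u a)\<^sup>2) = 1" using reflection_axis_norm[OF assms] by (simp add: N_def u_def)
  have "reflection_oracle d y * reflection_oracle d y = 1\<^sub>m N"
  proof (rule eq_matI)
    fix i j assume ij: "i < dim_row (1\<^sub>m N)" "j < dim_col (1\<^sub>m N)"
    have "(reflection_oracle d y * reflection_oracle d y) $$ (i, j)
      = (\<Sum>l<N. of_real (of_bool (i = l) - 2 * u i * u l) * of_real (of_bool (l = j) - 2 * u l * u j))"
      using ij by (auto simp: reflection_oracle_def scalar_prod_def u_def N_def atLeast0LessThan intro!: sum.cong)
    also have "\<dots> = complex_of_real (\<Sum>l<N. (of_bool (i = l) - 2 * u i * u l) * (of_bool (l = j) - 2 * u l * u j))"
      by simp
    also have "(\<Sum>l<N. (of_bool (i = l) - 2 * u i * u l) * (of_bool (l = j) - 2 * u l * u j))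
      = (\<Sum>l<N. ((if l = i then of_bool (i = j) - 2 * u i * u j else 0) - (if l = j then 2 * u i * u j else 0))
          + (u l)\<^sup>2 * (4 * u i * u j))"
      by (intro sum.cong) (auto simp: power2_eq_square algebra_simps)
    also have "\<dots> = of_bool (i = j) - 2 * u i * u j - 2 * u i * u j + (\<Sum>l<N. (u l)\<^sup>2) * (4 * u i * u j)"
      using ij by (simp add: sum.distrib sum_subtractf flip: sum_distrib_right)
    also have "\<dots> = of_bool (i = j)" by (simp add: un)
    finally show "(reflection_oracle d y * reflection_oracle d y) $$ (i, j) = 1\<^sub>m N $$ (i, j)"
      using ij by simp
  qed (auto simp: reflection_oracle_def N_def)
  then show ?thesis
    unfolding unitary_mat_def reflection_oracle_hermitian
    using reflection_oracle_carrier by (simp add: N_def)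
qed

lemma is_distribution_dim_pos: "is_distribution d p \<Longrightarrow> 0 < d"
  by (cases d) (auto simp: is_distribution_def)

lemma reflection_oracle_purified:
  assumes p: "is_distribution d p" and y: "\<And>i. i < d \<Longrightarrow> y i = \<sigma> i * sqrt (p i)"
    and \<sigma>: "\<And>i. \<sigma> i = 1 \<or> \<sigma> i = - 1"
  shows "purified_oracle d (Suc d) p (reflection_oracle d y)"
proof -
  have d: "0 < d" using p by (rule is_distribution_dim_pos)
  have \<sigma>2: "(\<sigma> i)\<^sup>2 = 1" for i using \<sigma>[of i] by auto
  have "(\<Sum>i<d. (y i)\<^sup>2) = (\<Sum>i<d. p i)"
    using p by (intro sum.cong) (auto simp: y power_mult_distrib \<sigma>2 is_distribution_def)
  then have yn: "(\<Sum>i<d. (y i)\<^sup>2) = 1" using p by (simp add: is_distribution_def)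
  define \<psi> :: "nat \<Rightarrow> complex vec" where
    "\<psi> i = vec (Suc d) (\<lambda>b. if b = Suc i then of_real (\<sigma> i) else 0)" for i
  show ?thesis
    unfolding purified_oracle_def
  proof (intro conjI exI[of _ \<psi>] allI impI)
    show "unitary_mat (d * Suc d) (reflection_oracle d y)"
      by (rule reflection_oracle_unitary[OF yn d])
    show "\<psi> i \<in> carrier_vec (Suc d)" for i by (simp add: \<psi>_def)
    show "\<psi> i \<bullet>c \<psi> j = (if i = j then 1 else 0)" if "i < d" "j < d" for i j
    proof -
      have "\<psi> i \<bullet>c \<psi> j = (\<Sum>b<Suc d. (if b = Suc i then of_real (\<sigma> i) else 0) * cnj (if b = Suc j then of_real (\<sigma> j) else 0))"
        by (auto simp: \<psi>_def scalar_prod_def atLeast0LessThan simp del: sum.lessThan_Suc intro!: sum.cong)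
      also have "\<dots> = (\<Sum>b<Suc d. if b = Suc i then (if i = j then of_real ((\<sigma> i)\<^sup>2) else 0) else 0)"
        by (intro sum.cong) (auto simp: power2_eq_square)
      also have "\<dots> = (if i = j then 1 else 0)"
        using that by (simp add: \<sigma>2 sum.delta del: sum.lessThan_Suc)
      finally show ?thesis .
    qed
    show "reflection_oracle d y *\<^sub>v unit_vec (d * Suc d) 0 = vec (d * Suc d)
       (\<lambda>n. complex_of_real (sqrt (p (n div Suc d))) * (\<psi> (n div Suc d) $ (n mod Suc d)))"
    proof (rule eq_vecI)
      fix n assume "n < dim_vec (vec (d * Suc d)
       (\<lambda>n. complex_of_real (sqrt (p (n div Suc d))) * (\<psi> (n div Suc d) $ (n mod Suc d))))"
      then have n: "n < d * Suc d" by simp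
      have "n div Suc d < d" "n mod Suc d < Suc d" using n by (auto intro!: less_mult_imp_div_less)
      have "(reflection_oracle d y *\<^sub>v unit_vec (d * Suc d) 0) $ n = reflection_oracle d y $$ (n, 0)"
        using n d reflection_oracle_carrier[of d y] by (subst index_mult_mat_vec) auto
      also have "\<dots> = of_real (of_bool (n = 0) - 2 * reflection_axis (Suc d) y n * (1 / sqrt 2))"
        using n d by (simp add: reflection_oracle_def reflection_axis_def)
      also have "of_bool (n = 0) - 2 * reflection_axis (Suc d) y n * (1 / sqrt 2)
         = (if n mod Suc d = Suc (n div Suc d) then y (n div Suc d) else 0)"
        by (auto simp: reflection_axis_def)
      also have "complex_of_real \<dots> = complex_of_real (sqrt (p (n div Suc d))) * (\<psi> (n div Suc d) $ (n mod Suc d))"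
        using \<open>n div Suc d < d\<close> \<open>n mod Suc d < Suc d\<close> y[of "n div Suc d"] by (auto simp: \<psi>_def)
      finally show "(reflection_oracle d y *\<^sub>v unit_vec (d * Suc d) 0) $ n = vec (d * Suc d)
       (\<lambda>n. complex_of_real (sqrt (p (n div Suc d))) * (\<psi> (n div Suc d) $ (n mod Suc d))) $ n"
        using n by simp
    qed (simp add: reflection_oracle_def)
  qed
qed

lemma reflection_oracle_ypoly:
  assumes "i < d * Suc d" "j < d * Suc d"
  shows "ypoly d 2 (\<lambda>y. reflection_oracle d y $$ (i, j))"
proof -
  have u: "ypoly d 1 (\<lambda>y. complex_of_real (reflection_axis (Suc d) y a))" if "a < d * Suc d" for a
  proof -
    have "a div Suc d < d" using that by (rule less_mult_imp_div_less)
    from ypoly_mult[OF ypoly_const[of d 0 "of_real (- 1 / sqrt 2)"] ypoly_var[OF this, of 1]]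
    have "ypoly d 1 (\<lambda>y. complex_of_real (- y (a div Suc d) / sqrt 2))" by simp
    then show ?thesis
      unfolding reflection_axis_def using ypoly_const[of d 1]
      by (cases "a = 0"; cases "a mod Suc d = Suc (a div Suc d)") simp_all
  qed
  have "ypoly d (0 + (1 + 1)) (\<lambda>y. of_bool (i = j) + (- 2) * (complex_of_real (reflection_axis (Suc d) y i) * complex_of_real (reflection_axis (Suc d) y j)))"
    by (intro ypoly_add ypoly_const ypoly_mult u assms)
  then have "ypoly d 2 (\<lambda>y. of_bool (i = j) - 2 * (complex_of_real (reflection_axis (Suc d) y i) * complex_of_real (reflection_axis (Suc d) y j)))"
    by (simp add: numeral_2_eq_2)
  then show ?thesis using assms by (cases "i = j") (simp_all add: reflection_oracle_def mult.assoc)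
qed

text \<open>The polynomial \<open>q\<close> is the acceptance probability of the algorithm run on the reflection
  oracles, averaged over the signs of the amplitudes, so that only the \<open>p i\<close> survive instead of
  their square roots.\<close>

lemma polynomial_method:
  assumes solv: "renyi_solvable \<alpha> d \<epsilon> T"
  obtains q :: "(nat \<Rightarrow> real) \<Rightarrow> real" where
    "\<And>p. is_distribution d p \<Longrightarrow> 0 \<le> q p \<and> q p \<le> 1"
    "\<And>p. is_distribution d p \<Longrightarrow> \<theta> + \<epsilon> < renyi_entropy \<alpha> d p \<Longrightarrow> 2 / 3 \<le> q p"
    "\<And>p. is_distribution d p \<Longrightarrow> renyi_entropy \<alpha> d p < \<theta> - \<epsilon> \<Longrightarrow> q p \<le> 1 / 3"
    "\<And>a b. \<exists>G. degree G \<le> 2 * T \<and> (\<forall>t. is_distribution d (\<lambda>i. a i + t * b i) \<longrightarrow>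
        q (\<lambda>i. a i + t * b i) = poly G t)"
proof -
  obtain w Vs qs out where alg: "valid_alg d (Suc d) T w Vs qs"
    and succ: "\<And>p U. is_distribution d p \<Longrightarrow> purified_oracle d (Suc d) p U \<Longrightarrow>
           2 / 3 \<le> success_prob d (Suc d) w U Vs qs out (renyi_entropy \<alpha> d p) \<epsilon>"
    using solv unfolding renyi_solvable_def by blast
  define N where "N = 2 * (d * Suc d * w)"
  have N: "N = 2 * (d * Suc d) * w" by (simp add: N_def)
  define st where "st y = final_state d (Suc d) w (reflection_oracle d y) Vs qs" for y
  define acc where "acc y = (\<Sum>n | n < N \<and> \<theta> \<le> out n. (cmod (st y $ n))\<^sup>2)" for y
  define q where "q p = (\<Sum>S\<in>Pow {..<d}. acc (flip_signs S (\<lambda>i. sqrt (p i)))) / 2 ^ d" for p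
  have w: "1 \<le> w" and len: "length qs = T" "length Vs = Suc (length qs)"
    and Vs: "\<forall>V\<in>set Vs. unitary_mat N V"
    using alg by (auto simp: valid_alg_def N)
  have "ystate d N (T * 2 + 0) st"
    unfolding st_def final_state_def N[symmetric] N_def len(1)[symmetric]
  proof (rule ystate_run_alg[OF reflection_oracle_carrier reflection_oracle_hermitian reflection_oracle_ypoly])
    show "\<forall>V\<in>set Vs. V \<in> carrier_mat (2 * (d * Suc d * w)) (2 * (d * Suc d * w))"
      using Vs by (auto simp: unitary_mat_def N_def)
    show "ystate d (2 * (d * Suc d * w)) 0 (\<lambda>y. unit_vec (2 * (d * Suc d * w)) 0)"
      by (simp add: ystate_def ypoly_const)
  qed (use len in auto)
  then have st: "ypoly d (2 * T) (\<lambda>y. st y $ n)" if "n < N" for n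
    using that by (simp add: ystate_def mult.commute)
  have acc_poly: "ypoly d (2 * (2 * T)) (\<lambda>y. complex_of_real (acc y))"
    unfolding acc_def of_real_sum complex_norm_square
    using ypoly_mult[OF st ypoly_cnj[OF st]] by (intro ypoly_sum) (simp add: mult_2)
  have orc: "2 / 3 \<le> success_prob d (Suc d) w (reflection_oracle d (flip_signs S (\<lambda>i. sqrt (p i)))) Vs qs out
       (renyi_entropy \<alpha> d p) \<epsilon>"
    and tot: "(\<Sum>n<N. (cmod (st (flip_signs S (\<lambda>i. sqrt (p i))) $ n))\<^sup>2) = 1"
    if p: "is_distribution d p" for p S
  proof -
    define y where "y = flip_signs S (\<lambda>i. sqrt (p i))"
    have pur: "purified_oracle d (Suc d) p (reflection_oracle d y)"
      by (rule reflection_oracle_purified[OF p, of _ "\<lambda>i. if i \<in> S then - 1 else 1"])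
        (auto simp: y_def flip_signs_def)
    from succ[OF p this] show "2 / 3 \<le> success_prob d (Suc d) w (reflection_oracle d (flip_signs S (\<lambda>i. sqrt (p i)))) Vs qs out
       (renyi_entropy \<alpha> d p) \<epsilon>" by (simp add: y_def)
    have U: "unitary_mat (d * Suc d) (reflection_oracle d y)" using pur by (simp add: purified_oracle_def)
    have "0 < N" using w is_distribution_dim_pos[OF p] by (simp add: N_def)
    have "(\<Sum>n<N. (cmod (st y $ n))\<^sup>2) = (\<Sum>n<N. (cmod (unit_vec N 0 $ n))\<^sup>2)"
      using run_alg_carrier_norm[OF U reflection_oracle_hermitian len(2), of w "unit_vec N 0"] Vs
      unfolding st_def final_state_def N[symmetric] by (simp add: N_def)
    also have "\<dots> = (\<Sum>n<N. if n = 0 then 1 else 0)" by (intro sum.cong) auto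
    also have "\<dots> = 1" using \<open>0 < N\<close> by simp
    finally show "(\<Sum>n<N. (cmod (st (flip_signs S (\<lambda>i. sqrt (p i))) $ n))\<^sup>2) = 1" by (simp add: y_def)
  qed
  have avg: "u \<le> q p \<and> q p \<le> v"
    if "\<And>S. u \<le> acc (flip_signs S (\<lambda>i. sqrt (p i))) \<and> acc (flip_signs S (\<lambda>i. sqrt (p i))) \<le> v" for p u v
  proof -
    have "(\<Sum>S\<in>Pow {..<d}. u) \<le> (\<Sum>S\<in>Pow {..<d}. acc (flip_signs S (\<lambda>i. sqrt (p i))))"
      "(\<Sum>S\<in>Pow {..<d}. acc (flip_signs S (\<lambda>i. sqrt (p i)))) \<le> (\<Sum>S\<in>Pow {..<d}. v)"
      using that by (intro sum_mono; simp)+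
    then show ?thesis by (simp add: q_def card_Pow field_simps)
  qed
  have acc01: "0 \<le> acc (flip_signs S (\<lambda>i. sqrt (p i))) \<and> acc (flip_signs S (\<lambda>i. sqrt (p i))) \<le> 1"
    if "is_distribution d p" for S p
  proof
    show "0 \<le> acc (flip_signs S (\<lambda>i. sqrt (p i)))" unfolding acc_def by (intro sum_nonneg) auto
    have "acc (flip_signs S (\<lambda>i. sqrt (p i))) \<le> (\<Sum>n<N. (cmod (st (flip_signs S (\<lambda>i. sqrt (p i))) $ n))\<^sup>2)"
      unfolding acc_def by (intro sum_mono2) auto
    then show "acc (flip_signs S (\<lambda>i. sqrt (p i))) \<le> 1" using tot[OF that] by simp
  qed
  show ?thesis
  proof
    show "0 \<le> q p \<and> q p \<le> 1" if "is_distribution d p" for p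
      using acc01[OF that] by (intro avg)
    show "2 / 3 \<le> q p" if p: "is_distribution d p" and h: "\<theta> + \<epsilon> < renyi_entropy \<alpha> d p" for p
    proof -
      have "2 / 3 \<le> acc (flip_signs S (\<lambda>i. sqrt (p i)))" for S
      proof -
        have "success_prob d (Suc d) w (reflection_oracle d (flip_signs S (\<lambda>i. sqrt (p i)))) Vs qs out
           (renyi_entropy \<alpha> d p) \<epsilon> \<le> acc (flip_signs S (\<lambda>i. sqrt (p i)))"
          unfolding success_prob_def acc_def st_def N using h by (intro sum_mono2) auto
        with orc[OF p, of S] show ?thesis by linarith
      qed
      with acc01[OF p] show ?thesis using avg[of "2 / 3" p 1] by blast
    qed
    show "q p \<le> 1 / 3" if p: "is_distribution d p" and h: "renyi_entropy \<alpha> d p < \<theta> - \<epsilon>" for p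
    proof -
      have "acc (flip_signs S (\<lambda>i. sqrt (p i))) \<le> 1 / 3" for S
      proof -
        define y where "y = flip_signs S (\<lambda>i. sqrt (p i))"
        have "2 / 3 + acc y \<le> success_prob d (Suc d) w (reflection_oracle d y) Vs qs out
           (renyi_entropy \<alpha> d p) \<epsilon> + acc y"
          using orc[OF p, of S] by (simp add: y_def)
        also have "\<dots> = (\<Sum>n\<in>{n. n < N \<and> \<bar>out n - renyi_entropy \<alpha> d p\<bar> \<le> \<epsilon>} \<union> {n. n < N \<and> \<theta> \<le> out n}. (cmod (st y $ n))\<^sup>2)"
          unfolding success_prob_def acc_def st_def N using h
          by (intro sum.union_disjoint[symmetric]) auto
        also have "\<dots> \<le> (\<Sum>n<N. (cmod (st y $ n))\<^sup>2)" by (intro sum_mono2) auto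
        also have "\<dots> = 1" using tot[OF p] by (simp add: y_def)
        finally show ?thesis by (simp add: y_def)
      qed
      with acc01[OF p] show ?thesis using avg[of 0 p "1 / 3"] by blast
    qed
    show "\<exists>G. degree G \<le> 2 * T \<and> (\<forall>t. is_distribution d (\<lambda>i. a i + t * b i) \<longrightarrow>
        q (\<lambda>i. a i + t * b i) = poly G t)" for a b
    proof -
      obtain G where "degree G \<le> 2 * T" "\<And>t. (\<forall>i<d. 0 \<le> a i + t * b i) \<Longrightarrow>
        (\<Sum>S\<in>Pow {..<d}. acc (flip_signs S (\<lambda>i. sqrt (a i + t * b i)))) = poly G t"
        using sign_average_ypoly[OF acc_poly, of a b] by auto
      then show ?thesis
        by (intro exI[of _ "smult (1 / 2 ^ d) G"])
          (auto simp: q_def is_distribution_def intro: order_trans[OF degree_smult_le])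
    qed
  qed
qed

section \<open>Random instances\<close>

lemma log_gap_thresholds:
  fixes \<alpha> \<epsilon> :: real
  assumes \<alpha>: "0 < \<alpha>" "\<alpha> < 1" and \<epsilon>: "\<epsilon> \<le> 1 / 32"
  defines "\<theta> \<equiv> (1 / (1 - \<alpha>)) * ((ln (5 / 4) + ln (9 / 8)) / 2)"
  shows "5 / 4 \<le> S \<Longrightarrow> \<theta> + \<epsilon> < (1 / (1 - \<alpha>)) * ln S"
    and "0 < S \<Longrightarrow> S \<le> 9 / 8 \<Longrightarrow> (1 / (1 - \<alpha>)) * ln S < \<theta> - \<epsilon>"
proof -
  have "ln (9 / 8 :: real) = ln (9 / 10) + ln (5 / 4)"
    using ln_mult[of "9 / 10" "5 / 4 :: real"] by simp
  moreover have "ln (9 / 10 :: real) \<le> 9 / 10 - 1" by (rule ln_le_minus_one) simp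
  ultimately have gap: "1 / 10 \<le> ln (5 / 4 :: real) - ln (9 / 8)" by simp
  have one: "1 \<le> 1 / (1 - \<alpha>)" using \<alpha> by simp
  have e: "\<epsilon> < (1 / (1 - \<alpha>)) * ((ln (5 / 4) - ln (9 / 8)) / 2)"
  proof -
    have "\<epsilon> < 1 * (1 / 10 / 2)" using \<epsilon> by simp
    also have "\<dots> \<le> (1 / (1 - \<alpha>)) * ((ln (5 / 4) - ln (9 / 8)) / 2)"
      using one gap \<alpha> by (intro mult_mono) auto
    finally show ?thesis .
  qed
  have half: "r * ((A + B) / 2) + \<epsilon> < r * A \<and> r * B < r * ((A + B) / 2) - \<epsilon>"
    if "\<epsilon> < r * ((A - B) / 2)" for r A B :: real
    using that by (simp add: field_simps)
  note e' = half[OF e, THEN conjunct1] and e'' = half[OF e, THEN conjunct2]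
  show "\<theta> + \<epsilon> < (1 / (1 - \<alpha>)) * ln S" if "5 / 4 \<le> S"
  proof -
    have "\<theta> + \<epsilon> < (1 / (1 - \<alpha>)) * ln (5 / 4)"
      unfolding \<theta>_def by (rule e')
    also have "\<dots> \<le> (1 / (1 - \<alpha>)) * ln S" using one that \<alpha> by (intro mult_left_mono) auto
    finally show ?thesis .
  qed
  show "(1 / (1 - \<alpha>)) * ln S < \<theta> - \<epsilon>" if "0 < S" "S \<le> 9 / 8"
  proof -
    have "(1 / (1 - \<alpha>)) * ln S \<le> (1 / (1 - \<alpha>)) * ln (9 / 8)" using one that \<alpha> by (intro mult_left_mono) auto
    also have "\<dots> < \<theta> - \<epsilon>" unfolding \<theta>_def by (rule e'')
    finally show ?thesis .
  qed
qed

lemma le_powr_of_le_one: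
  fixes x \<alpha> :: real
  assumes "0 \<le> x" "x \<le> 1" "\<alpha> \<le> 1"
  shows "x \<le> x powr \<alpha>"
  using assms powr_mono'[of \<alpha> 1 x] by (cases "x = 0") auto

text \<open>The distributions give the items \<open>1, \<dots>, m\<close> the masses \<open>\<beta> s^(b i)\<close> and the rest to
  item 0; \<open>\<beta>\<close> is chosen so that \<open>m\<close> items of mass \<open>\<beta> s\<close> contribute 1 to the power sum.\<close>

lemma random_instance_bound:
  fixes \<alpha> \<epsilon> s :: real and \<mu> \<nu> :: "nat \<Rightarrow> real" and m n T :: nat
  assumes \<alpha>: "0 < \<alpha>" "\<alpha> < 1" and n: "1 \<le> n" and s: "1 < s"
    and nn: "\<And>j. 0 \<le> \<mu> j" "\<And>j. 0 \<le> \<nu> j" "(\<Sum>j\<le>n. \<mu> j) = 1" "(\<Sum>j\<le>n. \<nu> j) = 1"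
    and mom: "\<And>r. r < n \<Longrightarrow> (\<Sum>j\<le>n. \<mu> j * (s ^ j) ^ r) = (\<Sum>j\<le>n. \<nu> j * (s ^ j) ^ r)"
    and \<nu>1: "(\<Sum>j\<le>n. \<nu> j * of_bool (j \<noteq> 1)) \<le> 1 / 60"
    and \<mu>1: "(\<Sum>j\<le>n. \<mu> j * (s ^ j / s) powr \<alpha>) \<le> 1 / 60"
    and solv: "renyi_solvable \<alpha> (Suc m) \<epsilon> T" and \<epsilon>: "\<epsilon> \<le> 1 / 32"
    and m: "1 \<le> m"
    and \<beta>_def: "\<beta> = real m powr (- 1 / \<alpha>) / s"
    and small: "real m * (\<beta> * s ^ n) \<le> 1 / 4"
  shows "1 / 6 \<le> real m * (4 * ((real (2 * T) + 1)\<^sup>2 / (1 / (2 * \<beta> * s ^ n) - 1)) ^ n)"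
proof -
  define \<theta> where "\<theta> = (1 / (1 - \<alpha>)) * ((ln (5 / 4) + ln (9 / 8 :: real)) / 2)"
  show ?thesis
  proof (rule polynomial_method[OF solv, where \<theta> = \<theta>])
    fix q :: "(nat \<Rightarrow> real) \<Rightarrow> real"
    assume q01: "\<And>p. is_distribution (Suc m) p \<Longrightarrow> 0 \<le> q p \<and> q p \<le> 1"
      and qhi: "\<And>p. is_distribution (Suc m) p \<Longrightarrow> \<theta> + \<epsilon> < renyi_entropy \<alpha> (Suc m) p \<Longrightarrow> 2 / 3 \<le> q p"
      and qlo: "\<And>p. is_distribution (Suc m) p \<Longrightarrow> renyi_entropy \<alpha> (Suc m) p < \<theta> - \<epsilon> \<Longrightarrow> q p \<le> 1 / 3"
      and qpoly: "\<And>a b. \<exists>G. degree G \<le> 2 * T \<and> (\<forall>t. is_distribution (Suc m) (\<lambda>i. a i + t * b i) \<longrightarrow>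
        q (\<lambda>i. a i + t * b i) = poly G t)"
    have \<beta>: "0 < \<beta>" using m s by (simp add: \<beta>_def)
    define R where "R = 1 / (2 * \<beta> * s ^ n)"
    have X: "1 * (\<beta> * s ^ n) \<le> real m * (\<beta> * s ^ n)" using m \<beta> s by (intro mult_right_mono) auto
    with small have \<beta>X: "\<beta> * s ^ n \<le> 1 / 4" by simp
    have X0: "0 < \<beta> * s ^ n" using \<beta> s by simp
    have R: "1 < R" using \<beta>X X0 unfolding R_def by (simp add: field_simps)
    define P where "P b i = (case i of 0 \<Rightarrow> 1 - \<beta> * (\<Sum>k<m. s ^ b k) | Suc k \<Rightarrow> \<beta> * s ^ b k)"
      for b :: "nat \<Rightarrow> nat" and i :: nat
    have spow: "s ^ j \<le> s ^ n" if "j \<le> n" for j using s that by (intro power_increasing) auto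
    have light: "\<beta> * (\<Sum>k\<in>A. s ^ b k) \<le> 1 / 4"
      if "A \<subseteq> {..<m}" "\<And>k. b k \<le> n" for A and b :: "nat \<Rightarrow> nat"
    proof -
      have "\<beta> * (\<Sum>k\<in>A. s ^ b k) \<le> \<beta> * (\<Sum>k<m. s ^ b k)"
        using that \<beta> s by (intro mult_left_mono sum_mono2) auto
      also have "\<dots> \<le> \<beta> * (\<Sum>k<m. s ^ n)"
        using that \<beta> by (intro mult_left_mono sum_mono spow) auto
      also have "\<dots> = real m * (\<beta> * s ^ n)" by simp
      finally show ?thesis using small by linarith
    qed
    have dist: "is_distribution (Suc m) (P b)" if "\<And>k. b k \<le> n" for b
      using light[of "{..<m}" b] that \<beta> s
      by (auto simp: is_distribution_def P_def sum.lessThan_Suc_shift sum_distrib_left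
          simp del: sum.lessThan_Suc split: nat.splits)
    define L where "L b = (\<Sum>k<m. (s ^ b k / s) powr \<alpha>) / real m" for b :: "nat \<Rightarrow> nat"
    have item: "(\<beta> * s ^ j) powr \<alpha> = (s ^ j / s) powr \<alpha> / real m" for j
    proof -
      have "\<beta> * s ^ j = real m powr (- 1 / \<alpha>) * (s ^ j / s)" by (simp add: \<beta>_def)
      also have "\<dots> powr \<alpha> = (real m powr (- 1 / \<alpha>)) powr \<alpha> * (s ^ j / s) powr \<alpha>"
        by (rule powr_mult)
      also have "(real m powr (- 1 / \<alpha>)) powr \<alpha> = 1 / real m"
        unfolding powr_powr using \<alpha> m by (simp add: powr_minus_divide)
      finally show ?thesis by simp
    qed
    have power_sum: "(\<Sum>i<Suc m. P b i powr \<alpha>) = P b 0 powr \<alpha> + L b" for b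
      by (simp add: sum.lessThan_Suc_shift P_def item L_def sum_divide_distrib del: sum.lessThan_Suc)
    have P0: "3 / 4 \<le> P b 0" "P b 0 \<le> 1" if "\<And>k. b k \<le> n" for b
      using light[of "{..<m}" b] that \<beta> s by (auto simp: P_def intro!: mult_nonneg_nonneg sum_nonneg)
    have P0\<alpha>: "3 / 4 \<le> P b 0 powr \<alpha>" "P b 0 powr \<alpha> \<le> 1" if "\<And>k. b k \<le> n" for b
      using le_powr_of_le_one[of "P b 0" \<alpha>] P0[of b, OF that] \<alpha> powr_mono2[of \<alpha> "P b 0" 1]
      by auto
    have diff: "(\<Sum>j\<le>n. \<nu> j * q (P (b(i := j)))) - (\<Sum>j\<le>n. \<mu> j * q (P (b(i := j))))
        \<le> 4 * ((real (2 * T) + 1)\<^sup>2 / (R - 1)) ^ n"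
      if b: "\<And>k. b k \<le> n" and i: "i < m" for b i
    proof -
      define A where "A k = (case k of 0 \<Rightarrow> 1 - \<beta> * (\<Sum>k\<in>{..<m}-{i}. s ^ b k)
        | Suc k \<Rightarrow> if k = i then 0 else \<beta> * s ^ b k)" for k
      define B where "B k = (case k of 0 \<Rightarrow> - \<beta> | Suc k \<Rightarrow> if k = i then \<beta> else 0)" for k
      have line: "P (b(i := j)) = (\<lambda>k. A k + s ^ j * B k)" for j
      proof
        fix k
        have "(\<Sum>k<m. s ^ (b(i := j)) k) = s ^ j + (\<Sum>k\<in>{..<m}-{i}. s ^ b k)"
          using i by (subst sum.remove[of _ i]) auto
        then show "P (b(i := j)) k = A k + s ^ j * B k"
          by (auto simp: P_def A_def B_def algebra_simps split: nat.splits)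
      qed
      have ld: "is_distribution (Suc m) (\<lambda>k. A k + t * B k)" if t: "0 \<le> t" "t \<le> R * s ^ n" for t
      proof -
        have "t * \<beta> \<le> 1 / 2"
        proof -
          have "t * \<beta> \<le> R * s ^ n * \<beta>" using t \<beta> by (intro mult_right_mono) auto
          also have "\<dots> = 1 / 2" using \<beta> s by (simp add: R_def)
          finally show ?thesis .
        qed
        moreover have "\<beta> * (\<Sum>k\<in>{..<m}-{i}. s ^ b k) \<le> 1 / 4" using b by (intro light) auto
        moreover have "(\<Sum>k<m. A (Suc k) + t * B (Suc k)) = \<beta> * (\<Sum>k\<in>{..<m}-{i}. s ^ b k) + t * \<beta>"
        proof -
          have "(\<Sum>k<m. A (Suc k) + t * B (Suc k)) = t * \<beta> + (\<Sum>k\<in>{..<m}-{i}. A (Suc k) + t * B (Suc k))"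
            using i by (subst sum.remove[of _ i]) (auto simp: A_def B_def)
          also have "(\<Sum>k\<in>{..<m}-{i}. A (Suc k) + t * B (Suc k)) = (\<Sum>k\<in>{..<m}-{i}. \<beta> * s ^ b k)"
            by (intro sum.cong) (auto simp: A_def B_def)
          finally show ?thesis by (simp add: sum_distrib_left)
        qed
        ultimately show ?thesis
          using t \<beta> s unfolding is_distribution_def sum.lessThan_Suc_shift
          by (auto simp: A_def B_def split: nat.splits)
      qed
      obtain G where G: "degree G \<le> 2 * T"
        "\<And>t. is_distribution (Suc m) (\<lambda>k. A k + t * B k) \<Longrightarrow> q (\<lambda>k. A k + t * B k) = poly G t"
        using qpoly[of A B] by blast
      have qG: "q (P (b(i := j))) = poly G (s ^ j)" if "j \<le> n" for j
        unfolding line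
      proof (rule G(2))
        have "(b(i := j)) k \<le> n" for k using b[of k] that by simp
        then show "is_distribution (Suc m) (\<lambda>k. A k + s ^ j * B k)" unfolding line[symmetric] by (rule dist)
      qed
      have "\<bar>(\<Sum>j\<le>n. \<nu> j * poly G (s ^ j)) - (\<Sum>j\<le>n. \<mu> j * poly G (s ^ j))\<bar>
         \<le> 4 * ((real (2 * T) + 1)\<^sup>2 / (R - 1)) ^ n"
      proof (rule moment_matching_poly_diff[OF G(1) n R nn mom])
        show "s ^ j \<le> s ^ n" if "j \<le> n" for j using that by (rule spow)
        show "0 \<le> poly G t \<and> poly G t \<le> 1" if "0 \<le> t" "t \<le> R * s ^ n" for t
          using q01[OF ld[OF that]] G(2)[OF ld[OF that]] by simp
      qed (use s in auto)
      then show ?thesis by (simp add: qG abs_le_iff)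
    qed
    have scale: "(\<Sum>j\<le>n. u j * (c * f j)) = c * (\<Sum>j\<le>n. u j * f j)" for u f :: "nat \<Rightarrow> real" and c
      by (simp only: sum_distrib_left mult.left_commute)
    have "2 / 3 - 1 / 3 \<le> real m * (2 / m / 60 + 8 / m / 60 + 4 * ((real (2 * T) + 1)\<^sup>2 / (R - 1)) ^ n)"
    proof (rule coordinatewise_hybrid[OF nn _ _ diff])
      show "(\<Sum>j\<le>n. \<nu> j * (2 / m * of_bool (j \<noteq> 1))) \<le> 2 / m / 60"
        using mult_left_mono[OF \<nu>1, of "2 / m"] unfolding scale by simp
      show "(\<Sum>j\<le>n. \<mu> j * (8 / m * (s ^ j / s) powr \<alpha>)) \<le> 8 / m / 60"
        using mult_left_mono[OF \<mu>1, of "8 / m"] unfolding scale by simp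
    next
      fix b :: "nat \<Rightarrow> nat" assume b: "\<And>k. b k \<le> n"
      define c where "c = (\<Sum>i<m. of_bool (b i \<noteq> 1) :: real)"
      have ceq: "(\<Sum>i<m. 2 / m * of_bool (b i \<noteq> 1)) = 2 * c / m"
        unfolding c_def sum_distrib_left sum_divide_distrib by (intro sum.cong) simp_all
      show "2 / 3 - (\<Sum>i<m. 2 / m * of_bool (b i \<noteq> 1)) \<le> q (P b)"
      proof (cases "real m / 2 \<le> c")
        case True
        then have "1 \<le> 2 * c / m" using m by (simp add: field_simps)
        then show ?thesis unfolding ceq using q01[OF dist[of b, OF b]] by linarith
      next
        case False
        have "real m - c = (\<Sum>i<m. 1 - of_bool (b i \<noteq> 1))" by (simp only: c_def sum_subtractf) simp
        also have "\<dots> \<le> (\<Sum>i<m. (s ^ b i / s) powr \<alpha>)"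
          using s by (intro sum_mono) auto
        finally have "(real m - c) / m \<le> L b" unfolding L_def by (intro divide_right_mono) auto
        moreover have "1 / 2 \<le> (real m - c) / m" using False m by (simp add: field_simps)
        ultimately have "5 / 4 \<le> (\<Sum>i<Suc m. P b i powr \<alpha>)"
          unfolding power_sum using P0\<alpha>[of b, OF b] by linarith
        then have "\<theta> + \<epsilon> < renyi_entropy \<alpha> (Suc m) (P b)"
          unfolding renyi_entropy_def \<theta>_def by (rule log_gap_thresholds(1)[OF \<alpha> \<epsilon>])
        then have "2 / 3 \<le> q (P b)" by (rule qhi[OF dist[of b, OF b]])
        moreover have "0 \<le> 2 * c / m" unfolding c_def by (intro divide_nonneg_nonneg mult_nonneg_nonneg sum_nonneg) auto
        ultimately show ?thesis unfolding ceq by linarith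
      qed
      have Leq: "(\<Sum>i<m. 8 / m * (s ^ b i / s) powr \<alpha>) = 8 * L b"
        unfolding L_def sum_distrib_left sum_divide_distrib by (intro sum.cong) simp_all
      have L0: "0 \<le> L b" unfolding L_def by (intro divide_nonneg_nonneg sum_nonneg) auto
      show "q (P b) \<le> 1 / 3 + (\<Sum>i<m. 8 / m * (s ^ b i / s) powr \<alpha>)"
      proof (cases "1 \<le> 8 * L b")
        case True
        then show ?thesis unfolding Leq using q01[OF dist[of b, OF b]] by linarith
      next
        case False
        then have "0 < (\<Sum>i<Suc m. P b i powr \<alpha>)" "(\<Sum>i<Suc m. P b i powr \<alpha>) \<le> 9 / 8"
          unfolding power_sum using P0\<alpha>[of b, OF b] L0 by linarith+
        then have "renyi_entropy \<alpha> (Suc m) (P b) < \<theta> - \<epsilon>"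
          unfolding renyi_entropy_def \<theta>_def by (rule log_gap_thresholds(2)[OF \<alpha> \<epsilon>])
        from qlo[OF dist[of b, OF b] this] show ?thesis unfolding Leq using L0 by linarith
      qed
    qed
    also have "\<dots> = 1 / 6 + real m * (4 * ((real (2 * T) + 1)\<^sup>2 / (R - 1)) ^ n)"
      using m by (simp add: field_simps)
    finally show ?thesis unfolding R_def by simp
  qed
qed

section \<open>Asymptotics\<close>

lemma eventually_renyi_lower_bound_large:
  fixes \<alpha> :: real
  assumes \<alpha>: "0 < \<alpha>" "\<alpha> < 1" and n: "2 \<le> n"
  shows "\<exists>D. \<forall>d\<ge>D. \<forall>\<epsilon> T. \<epsilon> \<le> 1 / 32 \<longrightarrow> renyi_solvable \<alpha> d \<epsilon> T \<longrightarrow>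
     real d powr (1 / (2 * \<alpha>) - 1 / real n) \<le> real T"
proof -
  obtain s :: real and \<mu> \<nu> :: "nat \<Rightarrow> real" where s: "1 < s"
    and nn: "\<And>j. 0 \<le> \<mu> j" "\<And>j. 0 \<le> \<nu> j" "(\<Sum>j\<le>n. \<mu> j) = 1" "(\<Sum>j\<le>n. \<nu> j) = 1"
    and mom: "\<And>r. r < n \<Longrightarrow> (\<Sum>j\<le>n. \<mu> j * (s ^ j) ^ r) = (\<Sum>j\<le>n. \<nu> j * (s ^ j) ^ r)"
    and \<nu>1: "(\<Sum>j\<le>n. \<nu> j * of_bool (j \<noteq> 1)) \<le> 1 / 60"
    and \<mu>1: "(\<Sum>j\<le>n. \<mu> j * (s ^ j / s) powr \<alpha>) \<le> 1 / 60"
    using moment_matching_weights[OF \<alpha>, of n "1 / 60"] n by auto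
  define \<gamma> where "\<gamma> = 1 / (2 * \<alpha>) - 1 / real n"
  define K where "K = 36 * 2 powr (1 / \<alpha>) * s ^ n / s"
  have K: "0 < K" using s by (simp add: K_def)
  have \<gamma>: "0 < \<gamma>"
  proof -
    have "1 / real n \<le> 1 / 2" using n by (intro divide_left_mono) auto
    also have "\<dots> < 1 / (2 * \<alpha>)" using \<alpha> by (intro divide_strict_left_mono) auto
    finally show ?thesis by (simp add: \<gamma>_def)
  qed
  have "(\<lambda>m::nat. real m powr (1 - 1 / \<alpha>) * (s ^ n / s)) \<longlonglongrightarrow> 0 * (s ^ n / s)"
    using \<alpha> by (intro tendsto_mult tendsto_const tendsto_neg_powr filterlim_real_sequentially)
      (auto simp: field_simps)
  then have "\<forall>\<^sub>F m in sequentially. real m powr (1 - 1 / \<alpha>) * (s ^ n / s) < 1 / 4"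
    by (intro order_tendstoD(2)) auto
  then obtain m0 where m0: "\<And>m. m0 \<le> m \<Longrightarrow> real m powr (1 - 1 / \<alpha>) * (s ^ n / s) < 1 / 4"
    by (auto simp: eventually_sequentially)
  have "real d powr \<gamma> \<le> real T"
    if d: "max (Suc (max m0 1)) (nat \<lceil>24 * K ^ n\<rceil> + 1) \<le> d"
      and \<epsilon>: "\<epsilon> \<le> 1 / 32" and solv: "renyi_solvable \<alpha> d \<epsilon> T" for d \<epsilon> T
  proof (rule ccontr)
    assume "\<not> real d powr \<gamma> \<le> real T"
    then have T: "real T < real d powr \<gamma>" by simp
    obtain m where m: "d = Suc m" "m0 \<le> m" "1 \<le> m" using d by (cases d) auto
    define \<beta> where "\<beta> = real m powr (- 1 / \<alpha>) / s"
    have \<beta>: "0 < \<beta>" using m s by (simp add: \<beta>_def)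
    have "real m * (\<beta> * s ^ n) = real m powr 1 * real m powr (- 1 / \<alpha>) * (s ^ n / s)"
      using m by (simp add: \<beta>_def)
    also have "\<dots> = real m powr (1 - 1 / \<alpha>) * (s ^ n / s)"
      unfolding powr_add[symmetric] by simp
    finally have small: "real m * (\<beta> * s ^ n) \<le> 1 / 4" using m0[OF m(2)] by simp
    have low: "1 / 6 \<le> real m * (4 * ((real (2 * T) + 1)\<^sup>2 / (1 / (2 * \<beta> * s ^ n) - 1)) ^ n)"
      using random_instance_bound[OF \<alpha> _ s nn mom \<nu>1 \<mu>1 solv[unfolded m(1)] \<epsilon> m(3) \<beta>_def small] n by simp
    have "1 * (\<beta> * s ^ n) \<le> real m * (\<beta> * s ^ n)" using m \<beta> s by (intro mult_right_mono) auto
    then have \<beta>X: "\<beta> * s ^ n \<le> 1 / 4" "0 < \<beta> * s ^ n" using small \<beta> s by (linarith, simp)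
    have half: "1 / (4 * (\<beta> * s ^ n)) \<le> 1 / (2 * \<beta> * s ^ n) - 1"
    proof -
      have "1 / (4 * z) \<le> 1 / (2 * z) - 1" if "0 < z" "z \<le> 1 / 4" for z :: real
        using that by (simp add: field_simps)
      from this[OF \<beta>X(2,1)] show ?thesis by (simp add: mult.assoc)
    qed
    have dpos: "1 \<le> real d" using m by simp
    have "2 * T + 1 \<le> 3 * real d powr \<gamma>"
      using T ge_one_powr_ge_zero[OF dpos less_imp_le[OF \<gamma>]] by simp
    then have "(real (2 * T) + 1)\<^sup>2 \<le> (3 * real d powr \<gamma>)\<^sup>2" by (intro power_mono) auto
    also have "\<dots> = 9 * real d powr (2 * \<gamma>)"
      using dpos by (simp add: power_mult_distrib powr_power mult.commute)
    finally have num: "(real (2 * T) + 1)\<^sup>2 \<le> 9 * real d powr (2 * \<gamma>)" .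
    have "real d powr (1 / \<alpha>) \<le> (2 * real m) powr (1 / \<alpha>)"
      using m \<alpha> by (intro powr_mono2) auto
    also have "\<dots> = 2 powr (1 / \<alpha>) * real m powr (1 / \<alpha>)" by (rule powr_mult)
    finally have dm: "real d powr (1 / \<alpha>) \<le> 2 powr (1 / \<alpha>) * real m powr (1 / \<alpha>)" .
    have \<beta>inv: "1 / (4 * (\<beta> * s ^ n)) = real m powr (1 / \<alpha>) * 9 * 2 powr (1 / \<alpha>) / K"
      using s by (simp add: \<beta>_def K_def powr_minus_divide)
    have "real d powr (1 / \<alpha>) * 9 / K \<le> 1 / (4 * (\<beta> * s ^ n))"
      unfolding \<beta>inv using dm K by (intro divide_right_mono) (auto simp: mult.commute)
    with half have den: "real d powr (1 / \<alpha>) * 9 / K \<le> 1 / (2 * \<beta> * s ^ n) - 1" by linarith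
    have den0: "0 < real d powr (1 / \<alpha>) * 9 / K" using dpos K by simp
    have "(real (2 * T) + 1)\<^sup>2 / (1 / (2 * \<beta> * s ^ n) - 1) \<le> 9 * real d powr (2 * \<gamma>) / (real d powr (1 / \<alpha>) * 9 / K)"
      by (intro frac_le num den den0) auto
    also have "\<dots> = K * (real d powr (2 * \<gamma>) / real d powr (1 / \<alpha>))"
      using dpos K by simp
    also have "real d powr (2 * \<gamma>) / real d powr (1 / \<alpha>) = real d powr (- 2 / real n)"
      unfolding powr_diff[symmetric] by (simp add: \<gamma>_def diff_divide_distrib right_diff_distrib)
    finally have ratio: "(real (2 * T) + 1)\<^sup>2 / (1 / (2 * \<beta> * s ^ n) - 1) \<le> K * real d powr (- 2 / real n)" .
    have "(K * real d powr (- 2 / real n)) ^ n = K ^ n * real d powr (- 2)"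
      using dpos n by (simp add: power_mult_distrib powr_power)
    also have "real d powr (- 2) = 1 / (real d)\<^sup>2"
      using dpos by (simp add: powr_minus_divide)
    finally have kn: "(K * real d powr (- 2 / real n)) ^ n = K ^ n * (1 / (real d)\<^sup>2)" .
    have "0 \<le> (real (2 * T) + 1)\<^sup>2 / (1 / (2 * \<beta> * s ^ n) - 1)"
      using den den0 by (intro divide_nonneg_nonneg) auto
    then have "real m * (4 * ((real (2 * T) + 1)\<^sup>2 / (1 / (2 * \<beta> * s ^ n) - 1)) ^ n)
       \<le> real d * (4 * (K ^ n * (1 / (real d)\<^sup>2)))"
      unfolding kn[symmetric] using m by (intro mult_mono power_mono ratio) auto
    also have "\<dots> = 4 * K ^ n / real d" using dpos by (simp add: power2_eq_square)
    also have "\<dots> < 1 / 6"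
    proof -
      have "24 * K ^ n < real d" using d by linarith
      then show ?thesis using dpos by (simp add: field_simps)
    qed
    finally show False using low by linarith
  qed
  then show ?thesis unfolding \<gamma>_def by blast
qed

lemma eventually_renyi_lower_bound_precision:
  fixes \<alpha> :: real
  assumes \<alpha>: "0 < \<alpha>" "\<alpha> < 1"
  shows "\<exists>c>0. \<exists>D. \<forall>d\<ge>D. \<forall>\<epsilon> T. 0 < \<epsilon> \<and> \<epsilon> \<le> 1 / 32 \<longrightarrow> renyi_solvable \<alpha> d \<epsilon> T \<longrightarrow>
     c * (real d powr (1 / (2 * \<alpha>) - 1 / 2) / \<epsilon> powr (1 / (2 * \<alpha>))) \<le> real T"
proof -
  define e where "e = 1 / (2 * \<alpha>) - 1 / 2"
  have e: "0 < e" using \<alpha> by (simp add: e_def field_simps)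
  define c where "c = (1 / 15) * 16 powr (- 1 / (2 * \<alpha>)) * 2 powr (- e)"
  have "(\<lambda>m::nat. real m powr (- (2 * e))) \<longlonglongrightarrow> 0"
    using e by (intro tendsto_neg_powr filterlim_real_sequentially) auto
  then have "\<forall>\<^sub>F m in sequentially. real m powr (- (2 * e)) < 1 / 100"
    by (intro order_tendstoD(2)) auto
  then obtain m0 where m0: "\<And>m. m0 \<le> m \<Longrightarrow> real m powr (- (2 * e)) < 1 / 100"
    by (auto simp: eventually_sequentially)
  have "c * (real d powr e / \<epsilon> powr (1 / (2 * \<alpha>))) \<le> real T"
    if d: "Suc (max m0 1) \<le> d" and \<epsilon>: "0 < \<epsilon>" "\<epsilon> \<le> 1 / 32" and solv: "renyi_solvable \<alpha> d \<epsilon> T" for d \<epsilon> T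
  proof -
    obtain m where m: "d = Suc m" "m0 \<le> m" "1 \<le> m" using d by (cases d) auto
    define \<delta> where "\<delta> = (16 * \<epsilon>) powr (1 / \<alpha>) * real m powr (- (2 * e))"
    have \<delta>0: "0 < \<delta>" using \<epsilon> m by (simp add: \<delta>_def)
    have "(16 * \<epsilon>) powr (1 / \<alpha>) \<le> (16 * \<epsilon>) powr 1"
      using \<epsilon> \<alpha> by (intro powr_mono') auto
    then have "(16 * \<epsilon>) powr (1 / \<alpha>) \<le> 16 * \<epsilon>" using \<epsilon> by simp
    then have "\<delta> \<le> 16 * \<epsilon> * (1 / 100)"
      unfolding \<delta>_def using m0[OF m(2)] \<epsilon> by (intro mult_mono) auto
    then have \<delta>: "\<delta> \<le> 8 * \<epsilon>" "\<delta> \<le> 1 / 200" using \<epsilon> by auto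
    define A where "A i = (of_bool (i = 0) :: real)" for i :: nat
    define B where "B i = (if i = (0::nat) then - \<delta> else \<delta> / real m)" for i :: nat
    have dist: "is_distribution d (\<lambda>i. A i + t * B i)" if t: "0 \<le> t" "t \<le> 1 / \<delta>" for t
    proof -
      have "t * \<delta> \<le> 1" using t \<delta>0 by (simp add: field_simps)
      then show ?thesis
        using t \<delta>0 m unfolding is_distribution_def m(1) sum.lessThan_Suc_shift
        by (auto simp: A_def B_def)
    qed
    have ent: "renyi_entropy \<alpha> d (\<lambda>i. A i + t * B i)
      = 1 / (1 - \<alpha>) * ln ((1 - t * \<delta>) powr \<alpha> + real m * (t * \<delta> / real m) powr \<alpha>)" for t
      unfolding renyi_entropy_def m(1) sum.lessThan_Suc_shift by (simp add: A_def B_def)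
    have ent0: "renyi_entropy \<alpha> d (\<lambda>i. A i + 0 * B i) < 2 * \<epsilon> - \<epsilon>"
      unfolding ent using \<epsilon> by simp
    have ent1: "2 * \<epsilon> + \<epsilon> < renyi_entropy \<alpha> d (\<lambda>i. A i + 1 * B i)"
    proof -
      have "real m * (\<delta> / real m) powr \<alpha> = real m powr 1 * (\<delta> powr \<alpha> / real m powr \<alpha>)"
        using m by (simp add: powr_divide)
      also have "\<delta> powr \<alpha> = ((16 * \<epsilon>) powr (1 / \<alpha>)) powr \<alpha> * (real m powr (- (2 * e))) powr \<alpha>"
        unfolding \<delta>_def by (rule powr_mult)
      also have "\<dots> = (16 * \<epsilon>) powr 1 * real m powr (- (1 - \<alpha>))"
      proof -
        have "- (2 * e) * \<alpha> = - (1 - \<alpha>)" "1 / \<alpha> * \<alpha> = 1"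
          using \<alpha> by (simp_all add: e_def field_simps)
        then show ?thesis unfolding powr_powr by (simp only:)
      qed
      also have "real m powr 1 * ((16 * \<epsilon>) powr 1 * real m powr (- (1 - \<alpha>)) / real m powr \<alpha>)
        = 16 * \<epsilon> * (real m powr 1 * real m powr (- (1 - \<alpha>)) * real m powr (- \<alpha>))"
        using \<epsilon> by (simp add: powr_minus_divide)
      also have "real m powr 1 * real m powr (- (1 - \<alpha>)) * real m powr (- \<alpha>) = 1"
        unfolding powr_add[symmetric] using m by simp
      finally have heavy: "real m * (\<delta> / real m) powr \<alpha> = 16 * \<epsilon>" by simp
      have "1 - \<delta> \<le> (1 - \<delta>) powr \<alpha>" using \<delta> \<delta>0 \<alpha> by (intro le_powr_of_le_one) auto
      then have ge: "1 + 8 * \<epsilon> \<le> (1 - \<delta>) powr \<alpha> + real m * (\<delta> / real m) powr \<alpha>"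
        unfolding heavy using \<delta> by linarith
      have "ln (1 / (1 + 8 * \<epsilon>)) \<le> 1 / (1 + 8 * \<epsilon>) - 1" using \<epsilon> by (intro ln_le_minus_one) auto
      then have "8 * \<epsilon> / (1 + 8 * \<epsilon>) \<le> ln (1 + 8 * \<epsilon>)" using \<epsilon> by (simp add: ln_div field_simps)
      moreover have "3 * \<epsilon> < 8 * \<epsilon> / (1 + 8 * \<epsilon>)" using \<epsilon> by (simp add: field_simps)
      ultimately have "3 * \<epsilon> < 1 * ln (1 + 8 * \<epsilon>)" by linarith
      also have "\<dots> \<le> 1 / (1 - \<alpha>) * ln (1 + 8 * \<epsilon>)" using \<alpha> \<epsilon> by (intro mult_right_mono) auto
      also have "\<dots> \<le> 1 / (1 - \<alpha>) * ln ((1 - \<delta>) powr \<alpha> + real m * (\<delta> / real m) powr \<alpha>)"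
        using ge \<alpha> \<epsilon> by (intro mult_left_mono) auto
      finally show ?thesis unfolding ent by simp
    qed
    have sq: "1 / 3 \<le> 4 * ((real (2 * T) + 1)\<^sup>2 / (1 / \<delta> - 1)) ^ 1"
    proof (rule polynomial_method[OF solv, where \<theta> = "2 * \<epsilon>"])
      fix q :: "(nat \<Rightarrow> real) \<Rightarrow> real"
      assume q01: "\<And>p. is_distribution d p \<Longrightarrow> 0 \<le> q p \<and> q p \<le> 1"
        and qhi: "\<And>p. is_distribution d p \<Longrightarrow> 2 * \<epsilon> + \<epsilon> < renyi_entropy \<alpha> d p \<Longrightarrow> 2 / 3 \<le> q p"
        and qlo: "\<And>p. is_distribution d p \<Longrightarrow> renyi_entropy \<alpha> d p < 2 * \<epsilon> - \<epsilon> \<Longrightarrow> q p \<le> 1 / 3"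
        and qpoly: "\<And>a b. \<exists>G. degree G \<le> 2 * T \<and> (\<forall>t. is_distribution d (\<lambda>i. a i + t * b i) \<longrightarrow>
          q (\<lambda>i. a i + t * b i) = poly G t)"
      obtain G where G: "degree G \<le> 2 * T"
        "\<And>t. is_distribution d (\<lambda>k. A k + t * B k) \<Longrightarrow> q (\<lambda>k. A k + t * B k) = poly G t"
        using qpoly[of A B] by blast
      have inv: "1 < 1 / \<delta>" using \<delta> \<delta>0 by simp
      define g where "g = G - [:poly G 0:]"
      have "\<bar>poly g 1\<bar> \<le> 4 * ((real (2 * T) + 1)\<^sup>2 / (1 / \<delta> - 1)) ^ 1"
      proof (rule bounded_poly_flat_at_zero[OF _ _ _ _ inv])
        show "degree g \<le> 2 * T" unfolding g_def using G(1) by (intro degree_diff_le) auto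
        show "coeff g r = 0" if "r < 1" for r using that by (simp add: g_def poly_0_coeff_0)
        show "\<bar>poly g t\<bar> \<le> 1" if t: "0 \<le> t" "t \<le> 1 / \<delta>" for t
          using q01[OF dist[OF t]] G(2)[OF dist[OF t]] q01[OF dist[of 0]] G(2)[OF dist[of 0]] \<delta>0
          by (simp add: g_def abs_le_iff)
      qed simp
      moreover have "2 / 3 \<le> poly G 1" using qhi[OF dist[of 1] ent1] G(2)[OF dist[of 1]] inv by simp
      moreover have "poly G 0 \<le> 1 / 3" using qlo[OF dist[of 0] ent0] G(2)[OF dist[of 0]] \<delta>0 by simp
      ultimately show ?thesis by (simp add: g_def abs_le_iff)
    qed
    define r where "r = 1 / \<delta>"
    have r: "200 \<le> r" using \<delta> \<delta>0 by (simp add: r_def field_simps)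
    have "(r - 1) / 12 \<le> (real (2 * T) + 1)\<^sup>2"
      using sq r unfolding r_def[symmetric] by (simp add: field_simps)
    then have low: "r \<le> 15 * (real (2 * T) + 1)\<^sup>2" "16 \<le> (real (2 * T) + 1)\<^sup>2"
      using r by (simp_all add: field_simps)
    then have "T \<noteq> 0" by (intro notI) simp
    then have "(real (2 * T) + 1)\<^sup>2 \<le> (3 * real T)\<^sup>2" by (intro power_mono) auto
    then have "r \<le> 15 * (3 * real T)\<^sup>2" using low(1) by linarith
    also have "\<dots> \<le> (15 * real T)\<^sup>2" by (simp add: power_mult_distrib)
    finally have "1 / \<delta> \<le> (15 * real T)\<^sup>2" by (simp only: r_def)
    then have "(1 / \<delta>) powr (1 / 2) \<le> ((15 * real T)\<^sup>2) powr (1 / 2)"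
      using \<delta>0 by (intro powr_mono2) auto
    then have T: "(1 / \<delta>) powr (1 / 2) \<le> 15 * real T"
      by (simp only: powr_half_sqrt zero_le_power2 real_sqrt_abs)
    have "real d powr e \<le> (2 * real m) powr e" using m e by (intro powr_mono2) auto
    then have dm: "real d powr e * 2 powr (- e) \<le> real m powr e"
      by (simp add: powr_mult powr_minus field_simps)
    have "(1 / \<delta>) powr (1 / 2) = \<delta> powr (- 1 / 2)"
      using \<delta>0 by (simp add: powr_divide powr_minus_divide)
    also have "\<dots> = 16 powr (- 1 / (2 * \<alpha>)) * \<epsilon> powr (- 1 / (2 * \<alpha>)) * real m powr e"
      unfolding \<delta>_def powr_mult powr_powr by (simp add: mult.commute)
    finally have eq: "(1 / \<delta>) powr (1 / 2) = 16 powr (- 1 / (2 * \<alpha>)) * \<epsilon> powr (- 1 / (2 * \<alpha>)) * real m powr e" .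
    have "c * (real d powr e / \<epsilon> powr (1 / (2 * \<alpha>)))
      = 1 / 15 * (16 powr (- 1 / (2 * \<alpha>)) * \<epsilon> powr (- 1 / (2 * \<alpha>)) * (real d powr e * 2 powr (- e)))"
      by (simp add: c_def powr_minus_divide)
    also have "\<dots> \<le> 1 / 15 * (16 powr (- 1 / (2 * \<alpha>)) * \<epsilon> powr (- 1 / (2 * \<alpha>)) * real m powr e)"
      by (intro mult_left_mono dm) auto
    also have "\<dots> \<le> real T" using T unfolding eq by linarith
    finally show ?thesis .
  qed
  moreover have "0 < c" by (simp add: c_def)
  ultimately show ?thesis unfolding e_def by blast
qed

lemma diagonal_rate:
  assumes "\<And>n. 2 \<le> n \<Longrightarrow> \<exists>D::nat. \<forall>d\<ge>D. Q d (1 / real n)"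
  shows "\<exists>f :: nat \<Rightarrow> real. f \<longlonglongrightarrow> 0 \<and> (\<exists>D. \<forall>d\<ge>D. Q d (f d))"
proof -
  from assms obtain D where D: "\<And>n d. 2 \<le> n \<Longrightarrow> D n \<le> d \<Longrightarrow> Q d (1 / real n)" by metis
  define S where "S d = {n. 2 \<le> n \<and> n \<le> d \<and> D n \<le> d}" for d
  have fin: "finite (S d)" for d by (rule finite_subset[of _ "{..d}"]) (auto simp: S_def)
  define f where "f d = 1 / real (Max (S d))" for d
  show ?thesis
  proof (intro exI conjI allI impI)
    show "f \<longlonglongrightarrow> 0"
    proof (rule LIMSEQ_I)
      fix r :: real assume "0 < r"
      then obtain k where k: "inverse (real (Suc k)) < r" using reals_Archimedean by blast
      show "\<exists>no. \<forall>d\<ge>no. norm (f d - 0) < r"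
      proof (intro exI allI impI)
        fix d assume d: "max (k + 2) (D (k + 2)) \<le> d"
        then have "k + 2 \<in> S d" by (simp add: S_def)
        then have "k + 2 \<le> Max (S d)" by (rule Max_ge[OF fin])
        then have "f d \<le> 1 / real (Suc k)" unfolding f_def by (intro divide_left_mono) auto
        then show "norm (f d - 0) < r" using k by (simp add: f_def inverse_eq_divide)
      qed
    qed
    fix d assume "max 2 (D 2) \<le> d"
    then have "2 \<in> S d" by (simp add: S_def)
    then have "Max (S d) \<in> S d" using fin by (intro Max_in) auto
    then show "Q d (f d)" unfolding f_def by (intro D) (auto simp: S_def)
  qed
qed

theorem theorem2p11:
  fixes \<alpha> :: real
  assumes "0 < \<alpha>" and "\<alpha> < 1"
  shows "\<exists>f :: nat \<Rightarrow> real. (f \<longlonglongrightarrow> 0) \<and>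
           (\<exists>c > 0. \<exists>\<epsilon>0 > 0. \<exists>d0. \<forall>d \<ge> d0. \<forall>\<epsilon>. 0 < \<epsilon> \<and> \<epsilon> \<le> \<epsilon>0 \<longrightarrow>
              (\<forall>T. renyi_solvable \<alpha> d \<epsilon> T \<longrightarrow>
                 real T \<ge> c * (real d powr (1 / (2 * \<alpha>) - f d)
                              + real d powr (1 / (2 * \<alpha>) - 1 / 2) / \<epsilon> powr (1 / (2 * \<alpha>)))))"
proof -
  obtain f D1 where f: "f \<longlonglongrightarrow> 0" and D1: "\<And>d. D1 \<le> d \<Longrightarrow> \<forall>\<epsilon> T. \<epsilon> \<le> 1 / 32 \<longrightarrow> renyi_solvable \<alpha> d \<epsilon> T \<longrightarrow>
     real d powr (1 / (2 * \<alpha>) - f d) \<le> real T"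
    using diagonal_rate[where Q = "\<lambda>d x. \<forall>\<epsilon> T. \<epsilon> \<le> 1 / 32 \<longrightarrow> renyi_solvable \<alpha> d \<epsilon> T \<longrightarrow>
        real d powr (1 / (2 * \<alpha>) - x) \<le> real T", OF eventually_renyi_lower_bound_large[OF assms]]
    by blast
  obtain c D2 where c: "0 < c" and D2: "\<And>d \<epsilon> T. D2 \<le> d \<Longrightarrow> 0 < \<epsilon> \<and> \<epsilon> \<le> 1 / 32 \<Longrightarrow> renyi_solvable \<alpha> d \<epsilon> T \<Longrightarrow>
     c * (real d powr (1 / (2 * \<alpha>) - 1 / 2) / \<epsilon> powr (1 / (2 * \<alpha>))) \<le> real T"
    using eventually_renyi_lower_bound_precision[OF assms] by blast
  have "min 1 c / 2 * (x + y) \<le> t" if "x \<le> t" "c * y \<le> t" "0 \<le> x" "0 \<le> y" for x y t :: real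
  proof -
    have "min 1 c * x \<le> 1 * x" "min 1 c * y \<le> c * y" using that by (intro mult_right_mono; simp)+
    then have "min 1 c * (x + y) \<le> 2 * t" using that by (simp add: distrib_left)
    then show ?thesis by simp
  qed
  then have "\<forall>d\<ge>max D1 D2. \<forall>\<epsilon>. 0 < \<epsilon> \<and> \<epsilon> \<le> 1 / 32 \<longrightarrow> (\<forall>T. renyi_solvable \<alpha> d \<epsilon> T \<longrightarrow>
      min 1 c / 2 * (real d powr (1 / (2 * \<alpha>) - f d)
        + real d powr (1 / (2 * \<alpha>) - 1 / 2) / \<epsilon> powr (1 / (2 * \<alpha>))) \<le> real T)"
    using D1 D2 by (auto simp del: times_divide_eq_right times_divide_eq_left)
  moreover have "0 < min 1 c / 2" "0 < (1 / 32 :: real)" using c by auto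
  ultimately show ?thesis using f by blast
qed

end
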